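(* Let $p>1$. The functional $\rho\mapsto C(\rho)$ is Lipschitz continuous, with respect to the $L^1$ distance, on any bounded subset of $L^p(\mathbb R^d)$: for every $M>0$ there exists a constant $L$ such that $$|C(\rho_1)-C(\rho_2)|\le L\,\|\rho_1-\rho_2\|_{L^1}$$ for all probability densities $\rho_1,\rho_2\in L^p(\mathbb R^d)$ with $\|\rho_1\|_p\le M$ and $\|\rho_2\|_p\le M$. In particular (for $d=3$), $C$ is Lipschitz continuous with respect to the $L^1$ distance on any bounded subset of $$\mathcal H=\Big\{\rho\in L^1(\mathbb R^3)\ :\ \rho\ge0,\ \sqrt\rho\in H^1(\mathbb R^3),\ \int\rho\,dx=1\Big\},$$ where bounded means that $\|\sqrt\rho\|_{H^1}$ is bounded on the subset.
   Context: $d\ge1$ and $N>1$ are integers; $\mathcal P(X)$ is the set of Borel probability measures on $X$, and a probability density on $\mathbb R^d$ is identified with the corresponding absolutely continuous probability measure. The function $\phi:(0,+\infty)\to[0,+\infty)$ is continuous, strictly decreasing, and $\lim_{t\to0^+}\phi(t)=+\infty$; by convention $\phi(0)=+\infty$. The cost is $c(x_1,\dots,x_N)=\sum_{1\le i<j\le N}\phi(|x_i-x_j|)$ for $x_1,\dots,x_N\in\mathbb R^d$. $\Pi(\rho)$ is the set of $P\in\mathcal P(\mathbb R^{Nd})$ all of whose $N$ marginals on the factors $\mathbb R^d$ are equal to $\rho$, and $C(\rho)=\min_{P\in\Pi(\rho)}\int c\,dP$. *)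

theory Defs
  imports "HOL-Probability.Probability"
begin

text \<open>Elements of \<open>L\<^sup>p\<close> are represented by Borel functions; functions that agree almost
  everywhere are not identified, so pointwise conditions are imposed almost everywhere.\<close>

definition in_Lp :: "real \<Rightarrow> ('a::euclidean_space \<Rightarrow> 'b::euclidean_space) \<Rightarrow> bool" where
  "in_Lp p f \<longleftrightarrow> f \<in> borel_measurable borel \<and> integrable lborel (\<lambda>x. norm (f x) powr p)"

definition Lp_norm :: "real \<Rightarrow> ('a::euclidean_space \<Rightarrow> 'b::euclidean_space) \<Rightarrow> real" where
  "Lp_norm p f = (LINT x|lborel. norm (f x) powr p) powr (1 / p)"

definition prob_density :: "('a::euclidean_space \<Rightarrow> real) \<Rightarrow> bool" where
  "prob_density \<rho> \<longleftrightarrow>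
     in_Lp 1 \<rho> \<and> (AE x in lborel. 0 \<le> \<rho> x) \<and> (LINT x|lborel. \<rho> x) = 1"

abbreviation density_measure :: "('a::euclidean_space \<Rightarrow> real) \<Rightarrow> 'a measure" where
  "density_measure \<rho> \<equiv> density lborel (\<lambda>x. ennreal (\<rho> x))"


subsection \<open>Multimarginal optimal transport\<close>

text \<open>\<open>\<phi>\<close> is only meaningful on \<open>(0, \<infinity>)\<close>; its value at 0 is overridden by \<open>\<infinity>\<close>.\<close>

definition phi_ext :: "(real \<Rightarrow> real) \<Rightarrow> real \<Rightarrow> ennreal" where
  "phi_ext \<phi> t = (if t = 0 then \<infinity> else ennreal (\<phi> t))"

text \<open>A point of \<open>(\<real>\<^sup>d)\<^sup>N\<close> is a function on the index set \<open>{..<N}\<close> (extensional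
  outside it).\<close>

definition cost :: "(real \<Rightarrow> real) \<Rightarrow> nat \<Rightarrow> (nat \<Rightarrow> 'a::euclidean_space) \<Rightarrow> ennreal" where
  "cost \<phi> N x = (\<Sum>j<N. \<Sum>i<j. phi_ext \<phi> (norm (x i - x j)))"

definition transport_plans ::
  "nat \<Rightarrow> 'a::euclidean_space measure \<Rightarrow> (nat \<Rightarrow> 'a) measure set" where
  "transport_plans N \<mu> = {P. prob_space P \<and> sets P = sets (Pi\<^sub>M {..<N} (\<lambda>_. borel)) \<and>
     (\<forall>i<N. distr P borel (\<lambda>x. x i) = \<mu>)}"

text \<open>The minimum is written as an infimum in \<open>[0, \<infinity>]\<close>.\<close>

definition transport_cost ::
  "(real \<Rightarrow> real) \<Rightarrow> nat \<Rightarrow> 'a::euclidean_space measure \<Rightarrow> ennreal" where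
  "transport_cost \<phi> N \<mu> = (INF P\<in>transport_plans N \<mu>. \<integral>\<^sup>+ x. cost \<phi> N x \<partial>P)"


subsection \<open>The Sobolev space \<open>H\<^sup>1\<close>\<close>

text \<open>\<open>f\<close> is of class \<open>C\<^sup>k\<close>: all iterated directional derivatives along basis
  vectors, up to order \<open>k\<close>, exist and are continuous.\<close>

fun C_class :: "nat \<Rightarrow> ('a::euclidean_space \<Rightarrow> real) \<Rightarrow> bool" where
  "C_class 0 f \<longleftrightarrow> continuous_on UNIV f"
| "C_class (Suc k) f \<longleftrightarrow> f differentiable_on UNIV \<and>
     (\<forall>b\<in>Basis. C_class k (\<lambda>x. frechet_derivative f (at x) b))"

definition test_function :: "('a::euclidean_space \<Rightarrow> real) \<Rightarrow> bool" where
  "test_function \<psi> \<longleftrightarrow> (\<forall>k. C_class k \<psi>) \<and> compact (closure {x. \<psi> x \<noteq> 0})"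

definition loc_integrable :: "('a::euclidean_space \<Rightarrow> 'b::euclidean_space) \<Rightarrow> bool" where
  "loc_integrable f \<longleftrightarrow> f \<in> borel_measurable borel \<and>
     (\<forall>K. compact K \<longrightarrow> set_integrable lborel K f)"

definition has_weak_gradient :: "('a::euclidean_space \<Rightarrow> real) \<Rightarrow> ('a \<Rightarrow> 'a) \<Rightarrow> bool" where
  "has_weak_gradient u g \<longleftrightarrow> loc_integrable u \<and> loc_integrable g \<and>
     (\<forall>\<psi> b. test_function \<psi> \<longrightarrow> b \<in> Basis \<longrightarrow>
        (LINT x|lborel. u x * frechet_derivative \<psi> (at x) b) =
        - (LINT x|lborel. (g x \<bullet> b) * \<psi> x))"

definition in_H1 :: "('a::euclidean_space \<Rightarrow> real) \<Rightarrow> bool" where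
  "in_H1 u \<longleftrightarrow> in_Lp 2 u \<and> (\<exists>g. has_weak_gradient u g \<and> in_Lp 2 g)"

text \<open>The weak gradient is unique up to null sets, so the choice does not affect the norm.\<close>

definition weak_gradient :: "('a::euclidean_space \<Rightarrow> real) \<Rightarrow> 'a \<Rightarrow> 'a" where
  "weak_gradient u = (SOME g. has_weak_gradient u g \<and> in_Lp 2 g)"

definition H1_norm :: "('a::euclidean_space \<Rightarrow> real) \<Rightarrow> real" where
  "H1_norm u = sqrt ((Lp_norm 2 u)\<^sup>2 + (Lp_norm 2 (weak_gradient u))\<^sup>2)"

definition H_densities :: "('a::euclidean_space \<Rightarrow> real) set" where
  "H_densities = {\<rho>. in_Lp 1 \<rho> \<and> (AE x in lborel. 0 \<le> \<rho> x) \<and>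
     in_H1 (\<lambda>x. sqrt (\<rho> x)) \<and> (LINT x|lborel. \<rho> x) = 1}"


subsection \<open>Lipschitz estimate in \<open>L\<^sup>1\<close>\<close>

text \<open>\<open>C\<close> is finite on \<open>S\<close> and Lipschitz there; finiteness is stated explicitly because
  \<^const>\<open>enn2real\<close> sends \<open>\<infinity>\<close> to 0.\<close>

definition cost_L1_lipschitz_on ::
  "real \<Rightarrow> (real \<Rightarrow> real) \<Rightarrow> nat \<Rightarrow> ('a::euclidean_space \<Rightarrow> real) set \<Rightarrow> bool" where
  "cost_L1_lipschitz_on L \<phi> N S \<longleftrightarrow>
     (\<forall>\<rho>\<in>S. transport_cost \<phi> N (density_measure \<rho>) < \<infinity>) \<and>
     (\<forall>\<rho>\<^sub>1\<in>S. \<forall>\<rho>\<^sub>2\<in>S.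
        \<bar>enn2real (transport_cost \<phi> N (density_measure \<rho>\<^sub>1)) -
         enn2real (transport_cost \<phi> N (density_measure \<rho>\<^sub>2))\<bar>
        \<le> L * Lp_norm 1 (\<lambda>x. \<rho>\<^sub>1 x - \<rho>\<^sub>2 x))"

end

theory Submission
  imports Defs
begin

text \<open>
  Suppose a sub-plan \<open>P\<close> of mass \<open>s\<close> lacks marginals \<open>\<nu>\<^sub>i\<close> of mass \<open>\<delta> \<le> s / (2N)\<close>. Form an
  \<open>N \<times> N\<close> array whose first row is drawn from \<open>\<Otimes> \<nu>\<^sub>i\<close> and whose other rows are tuples drawn from \<open>P\<close>,
  conditioned on entries in different rows and columns being at distance at least \<open>r\<close>. Replacing those
  \<open>N - 1\<close> tuples of \<open>P\<close> by the \<open>N\<close> cyclic diagonals of the array adds exactly \<open>\<nu>\<^sub>i\<close> to the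
  marginals, and each diagonal costs at most \<open>N\<^sup>2 \<phi>(r)\<close>. Hence, as soon as \<open>\<rho>\<close> gives little mass to
  every ball of radius \<open>r\<close>, a sub-plan of mass \<open>s \<ge> 1/2\<close> dominated by \<open>\<rho>\<close> extends to a plan at an extra
  cost proportional to \<open>1 - s\<close>. Starting from the product measure restricted to separated points, this
  bounds \<open>C(\<rho>)\<close>; starting from a plan of \<open>\<rho>\<^sub>1\<close> thinned by \<open>\<Prod> min(1, \<rho>\<^sub>2/\<rho>\<^sub>1)(x\<^sub>i)\<close>, which loses mass at most
  \<open>N \<parallel>\<rho>\<^sub>1 - \<rho>\<^sub>2\<parallel>\<close>, it gives the Lipschitz estimate. No duality is needed.

  The uniform bound on the mass of small balls follows in \<open>L\<^sup>p\<close> from \<open>\<rho> \<le> T + T\<^sup>1\<^sup>-\<^sup>p \<rho>\<^sup>p\<close>. For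
  \<open>\<rho> = u\<^sup>2\<close> with \<open>u\<close> in \<open>H\<^sup>1\<close>, Sobolev's embedding is not needed: the mass of \<open>u\<^sup>2\<close> on a ball is
  comparable to that on its translates up to a multiple of the gradient, and one of \<open>K\<close> disjoint
  translates carries at most \<open>1 / K\<close> of the total.
\<close>

section \<open>Rearranging sub-plans\<close>

definition sum_measure :: "'a measure \<Rightarrow> 'i set \<Rightarrow> ('i \<Rightarrow> 'a measure) \<Rightarrow> 'a measure" where
  "sum_measure E I \<mu> = measure_of (space E) (sets E) (\<lambda>A. \<Sum>i\<in>I. emeasure (\<mu> i) A)"

lemma sets_sum_measure [simp, measurable_cong]: "sets (sum_measure E I \<mu>) = sets E"
  by (simp add: sum_measure_def)

lemma space_sum_measure [simp]: "space (sum_measure E I \<mu>) = space E"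
  by (simp add: sum_measure_def)

text \<open>\<open>measure_of\<close> falls back to the null measure unless its set function is a
  measure, so countable additivity comes first: the finite sum is exchanged with the series over the
  disjoint family.\<close>

lemma emeasure_sum_measure:
  assumes \<mu>: "\<And>i. i \<in> I \<Longrightarrow> sets (\<mu> i) = sets E" and A: "A \<in> sets E"
  shows "emeasure (sum_measure E I \<mu>) A = (\<Sum>i\<in>I. emeasure (\<mu> i) A)"
  unfolding sum_measure_def
proof (rule emeasure_measure_of_sigma)
  show "countably_additive (sets E) (\<lambda>A. \<Sum>i\<in>I. emeasure (\<mu> i) A)"
  proof (rule countably_additiveI)
    fix A :: "nat \<Rightarrow> _" assume A: "range A \<subseteq> sets E" "disjoint_family A"
    have "(\<Sum>n. \<Sum>i\<in>I. emeasure (\<mu> i) (A n)) = (\<Sum>i\<in>I. \<Sum>n. emeasure (\<mu> i) (A n))"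
      by (intro suminf_sum summableI)
    also have "\<dots> = (\<Sum>i\<in>I. emeasure (\<mu> i) (\<Union>n. A n))"
      using A by (intro sum.cong refl suminf_emeasure) (auto simp: \<mu>)
    finally show "(\<Sum>n. \<Sum>i\<in>I. emeasure (\<mu> i) (A n)) = (\<Sum>i\<in>I. emeasure (\<mu> i) (\<Union>n. A n))" .
  qed
qed (auto simp: positive_def A sets.sigma_algebra_axioms)

lemma nn_integral_sum_measure:
  assumes \<mu>: "\<And>i. i \<in> I \<Longrightarrow> sets (\<mu> i) = sets E" and f: "f \<in> borel_measurable E"
  shows "(\<integral>\<^sup>+x. f x \<partial>sum_measure E I \<mu>) = (\<Sum>i\<in>I. \<integral>\<^sup>+x. f x \<partial>\<mu> i)"
proof -
  have meas: "f \<in> borel_measurable (\<mu> i)" if "f \<in> borel_measurable E" "i \<in> I" for i and f :: "_ \<Rightarrow> ennreal"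
    using that by (simp cong: measurable_cong_sets add: \<mu>)
  from f show ?thesis
  proof induction
    case (cong f g)
    have "(\<integral>\<^sup>+x. f x \<partial>\<mu> i) = (\<integral>\<^sup>+x. g x \<partial>\<mu> i)" if "i \<in> I" for i
      using cong.hyps sets_eq_imp_space_eq[OF \<mu>[OF that]] by (intro nn_integral_cong) auto
    moreover have "(\<integral>\<^sup>+x. f x \<partial>sum_measure E I \<mu>) = (\<integral>\<^sup>+x. g x \<partial>sum_measure E I \<mu>)"
      using cong.hyps by (intro nn_integral_cong) auto
    ultimately show ?case
      using cong.IH by simp
  next
    case (set A)
    then show ?case
      by (simp add: emeasure_sum_measure \<mu>)
  next
    case (mult f c)
    have "f \<in> borel_measurable (\<mu> i)" if "i \<in> I" for i
      using mult.hyps that by (intro meas)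
    then show ?case
      using mult by (simp add: nn_integral_cmult sum_distrib_left)
  next
    case (add f g)
    have "f \<in> borel_measurable (\<mu> i)" "g \<in> borel_measurable (\<mu> i)" if "i \<in> I" for i
      using add.hyps that by (auto intro: meas)
    then show ?case
      using add by (simp add: nn_integral_add sum.distrib)
  next
    case (seq F)
    have F: "F n \<in> borel_measurable (\<mu> i)" if "i \<in> I" for i n
      using seq.hyps that by (auto intro: meas)
    have "(\<integral>\<^sup>+x. (SUP n. F n x) \<partial>sum_measure E I \<mu>) = (SUP n. \<Sum>i\<in>I. \<integral>\<^sup>+x. F n x \<partial>\<mu> i)"
      using seq by (subst nn_integral_monotone_convergence_SUP) auto
    also have "\<dots> = (\<Sum>i\<in>I. SUP n. \<integral>\<^sup>+x. F n x \<partial>\<mu> i)"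
      using \<open>incseq F\<close>
      by (intro ennreal_SUP_sum) (auto simp: incseq_def le_fun_def intro!: nn_integral_mono)
    also have "\<dots> = (\<Sum>i\<in>I. \<integral>\<^sup>+x. (SUP n. F n x) \<partial>\<mu> i)"
      using seq F by (intro sum.cong refl nn_integral_monotone_convergence_SUP[symmetric]) auto
    finally show ?case
      by (simp add: SUP_apply image_image)
  qed
qed

section \<open>Independent tuples conditioned on separation\<close>

text \<open>Entries of one row are not compared with each other: a row is one sampled tuple, whose
  own points may be close. A cyclic diagonal meets each row and each column once, so this condition
  still controls its cost.\<close>

definition well_separated :: "real \<Rightarrow> nat \<Rightarrow> (nat \<Rightarrow> nat \<Rightarrow> 'a::metric_space) \<Rightarrow> bool" where
  "well_separated r N w \<longleftrightarrow>
     (\<forall>a<N. \<forall>b<N. \<forall>i<N. \<forall>j<N. a \<noteq> b \<longrightarrow> i \<noteq> j \<longrightarrow> r \<le> dist (w a i) (w b j))"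

text \<open>Integrate over coordinate \<open>a\<close> first: the other coordinates are frozen,
  \<open>g (x b)\<close> becomes a fixed centre, and the bound on \<open>f\<close>, uniform in the
  centre, applies. General \<open>f\<close> and \<open>g\<close> cover both components of tuples and
  single points.\<close>

lemma emeasure_PiM_close:
  fixes f :: "'b \<Rightarrow> 'a::euclidean_space" and g :: "'b \<Rightarrow> 'a"
  assumes P: "prob_space P" and I: "finite I" "a \<in> I" "b \<in> I" "a \<noteq> b"
    and [measurable]: "f \<in> borel_measurable P" "g \<in> borel_measurable P"
    and close: "\<And>z. emeasure P {y \<in> space P. dist (f y) z < r} \<le> \<eta>"
  shows "emeasure (PiM I (\<lambda>_. P)) {x \<in> space (PiM I (\<lambda>_. P)). dist (f (x a)) (g (x b)) < r} \<le> \<eta>"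
proof -
  interpret P: prob_space P by fact
  interpret PP: product_prob_space "\<lambda>_. P" ..
  define J where "J = I - {a}"
  have J: "finite J" "a \<notin> J" "I = insert a J" "b \<in> J"
    using I by (auto simp: J_def)
  have [measurable]: "(\<lambda>x. x a) \<in> measurable (PiM I (\<lambda>_. P)) P"
     "(\<lambda>x. x b) \<in> measurable (PiM I (\<lambda>_. P)) P" "(\<lambda>x. x b) \<in> measurable (PiM J (\<lambda>_. P)) P"
    using I J by (auto intro: measurable_component_singleton)
  let ?A = "{x \<in> space (PiM I (\<lambda>_. P)). dist (f (x a)) (g (x b)) < r}"
  have A[measurable]: "?A \<in> sets (PiM I (\<lambda>_. P))"
    by measurable
  interpret J: prob_space "PiM J (\<lambda>_. P)"
    by (intro prob_space_PiM P)
  have "emeasure (PiM I (\<lambda>_. P)) ?A = (\<integral>\<^sup>+x. indicator ?A x \<partial>PiM (insert a J) (\<lambda>_. P))"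
    using A J by simp
  also have "\<dots> = (\<integral>\<^sup>+x. (\<integral>\<^sup>+y. indicator ?A (x(a := y)) \<partial>P) \<partial>PiM J (\<lambda>_. P))"
    using J A by (intro PP.product_nn_integral_insert) auto
  also have "\<dots> \<le> (\<integral>\<^sup>+x. \<eta> \<partial>PiM J (\<lambda>_. P))"
  proof (rule nn_integral_mono)
    fix x assume x: "x \<in> space (PiM J (\<lambda>_. P))"
    have "(\<integral>\<^sup>+y. indicator ?A (x(a := y)) \<partial>P) \<le> (\<integral>\<^sup>+y. indicator {y \<in> space P. dist (f y) (g (x b)) < r} y \<partial>P)"
      using J by (intro nn_integral_mono) (auto simp: indicator_def)
    also have "\<dots> \<le> \<eta>"
      using close by simp
    finally show "(\<integral>\<^sup>+y. indicator ?A (x(a := y)) \<partial>P) \<le> \<eta>" .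
  qed
  also have "\<dots> = \<eta>"
    by (simp add: J.emeasure_space_1)
  finally show ?thesis .
qed

lemma ennreal_inverse_le_2:
  fixes x :: ennreal
  assumes "inverse 2 \<le> x" shows "inverse x \<le> 2"
proof (cases x)
  case (real t)
  have "ennreal (1/2) \<le> ennreal t"
    using assms real by simp
  then have "1/2 \<le> t"
    using real by (subst (asm) ennreal_le_iff) auto
  then have "inverse t \<le> 2" "inverse x = ennreal (inverse t)"
    using real by (auto simp: field_simps inverse_ennreal)
  then have "inverse x \<le> ennreal 2"
    by (simp only: ennreal_leI)
  then show ?thesis by simp
qed simp

text \<open>Row 0 of the array is a sample of \<open>Z\<close> and the other rows are independent samples of \<open>P\<close>. The
  conditioning on separation is normalised separately for each value of row 0: this keeps its law
  equal to \<open>Z\<close>, while the laws of the other rows at most double.\<close>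

lemma conditioned_sample:
  fixes P :: "(nat \<Rightarrow> 'a::euclidean_space) measure"
  assumes E_def: "E = PiM {..<N} (\<lambda>_. borel :: 'a measure)"
    and P: "prob_space P" "sets P = sets E" and Z: "prob_space Z" "sets Z = sets E"
    and N: "N > 0"
    and close: "\<And>j z. j < N \<Longrightarrow> emeasure P {y \<in> space P. dist (y j) z < r} \<le> ennreal (1 / (2 * real N ^ 4))"
  obtains \<Lambda> :: "(nat \<Rightarrow> nat \<Rightarrow> 'a) measure"
  where "prob_space \<Lambda>" "sets \<Lambda> = sets (PiM {..<N} (\<lambda>_. E))" "AE w in \<Lambda>. well_separated r N w"
    "\<And>A. A \<in> sets E \<Longrightarrow> emeasure (distr \<Lambda> E (\<lambda>w. w 0)) A = emeasure Z A"
    "\<And>a A. 1 \<le> a \<Longrightarrow> a < N \<Longrightarrow> A \<in> sets E \<Longrightarrow> emeasure (distr \<Lambda> E (\<lambda>w. w a)) A \<le> 2 * emeasure P A"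
proof -
  interpret P: prob_space P by fact
  interpret Z: prob_space Z by fact
  define I where "I = {1..<N}"
  define X where "X = PiM I (\<lambda>_. P)"
  have I: "finite I" "0 \<notin> I" "insert 0 I = {..<N}"
    using N by (auto simp: I_def)
  interpret PP: product_prob_space "\<lambda>_. P" I ..
  interpret X: prob_space X
    unfolding X_def by (intro prob_space_PiM P)
  interpret ZX: pair_prob_space Z X ..
  note Z(2)[measurable_cong] P(2)[measurable_cong]
  let ?W = "PiM {..<N} (\<lambda>_. E)"
  \<comment> \<open>\<open>F\<close> inserts the sample \<open>z\<close> of \<open>Z\<close> as row
    0 next to the independent rows indexed by \<open>I\<close>.\<close>
  define F :: "(nat \<Rightarrow> 'a) \<times> (nat \<Rightarrow> nat \<Rightarrow> 'a) \<Rightarrow> nat \<Rightarrow> nat \<Rightarrow> 'a"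
    where "F = (\<lambda>(z, x). x(0 := z))"
  have sets_X: "sets X = sets (PiM I (\<lambda>_. E))"
    unfolding X_def by (intro sets_PiM_cong refl) (simp add: P)
  note sets_X[measurable_cong]
  have spZ: "space Z = space E" and spP: "space P = space E"
    using Z(2) P(2) by (auto dest: sets_eq_imp_space_eq)
  have F[measurable]: "F \<in> measurable (Z \<Otimes>\<^sub>M X) ?W"
    unfolding F_def case_prod_beta I(3)[symmetric]
    by (intro measurable_fun_upd[where J=I]) auto
  have Ei: "(\<lambda>y. y i) \<in> borel_measurable E" if "i < N" for i
    using that unfolding E_def by (intro measurable_component_singleton) auto
  have Pi: "(\<lambda>y. y i) \<in> borel_measurable P" if "i < N" for i
    by (subst measurable_cong_sets[OF P(2) refl]) (rule Ei[OF that])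
  have wai[measurable]: "(\<lambda>w. w a i) \<in> borel_measurable ?W" if "a < N" "i < N" for a i
  proof -
    have "(\<lambda>w. w a) \<in> measurable ?W E"
      using that by (intro measurable_component_singleton) auto
    then show ?thesis
      using Ei[OF that(2)] by (rule measurable_compose)
  qed
  define G where "G = {w \<in> space ?W. well_separated r N w}"
  \<comment> \<open>Separation is a finite conjunction over these index quadruples. This yields
    measurability of \<open>G\<close>, and their number, at most \<open>N ^ 4\<close>, enters the
    union bound.\<close>
  define Q where "Q = {(a, b, i, j). a < N \<and> b < N \<and> i < N \<and> j < N \<and> a \<noteq> b \<and> i \<noteq> j}"
  have Qsub: "Q \<subseteq> {..<N} \<times> {..<N} \<times> {..<N} \<times> {..<N}"
    by (auto simp: Q_def)
  then have Qfin: "finite Q"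
    by (rule finite_subset) auto
  have G_alt: "G = {w \<in> space ?W. \<forall>q\<in>Q. case q of (a, b, i, j) \<Rightarrow> r \<le> dist (w a i) (w b j)}"
    by (auto simp: G_def well_separated_def Q_def)
  have G[measurable]: "G \<in> sets ?W"
    unfolding G_alt
  proof (rule sets.sets_Collect_finite_All[OF _ Qfin])
    fix q assume "q \<in> Q"
    then obtain a b i j where q: "q = (a, b, i, j)" "a < N" "b < N" "i < N" "j < N"
      unfolding Q_def by blast
    have "(\<lambda>w. dist (w a i) (w b j)) \<in> borel_measurable ?W"
      using q by (intro borel_measurable_dist wai)
    then show "{w \<in> space ?W. case q of (a, b, i, j) \<Rightarrow> r \<le> dist (w a i) (w b j)} \<in> sets ?W"
      unfolding q by simp
  qed
  \<comment> \<open>The probability that the array is separated, given that its row 0 is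
    \<open>z\<close>.\<close>
  define m where "m z = emeasure X {x \<in> space X. F (z, x) \<in> G}" for z
  have m_alt: "m z = (\<integral>\<^sup>+x. indicator G (F (z, x)) \<partial>X)" if "z \<in> space Z" for z
  proof -
    have "m z = (\<integral>\<^sup>+x. indicator {x \<in> space X. F (z, x) \<in> G} x \<partial>X)"
      unfolding m_def using that by (subst nn_integral_indicator) auto
    also have "\<dots> = (\<integral>\<^sup>+x. indicator G (F (z, x)) \<partial>X)"
      by (intro nn_integral_cong) (auto simp: indicator_def)
    finally show ?thesis .
  qed
  have [measurable]: "(\<lambda>z. \<integral>\<^sup>+x. indicator G (F (z, x)) \<partial>X) \<in> borel_measurable Z"
    by measurable
  have m_meas[measurable]: "m \<in> borel_measurable Z"
    using m_alt by (subst measurable_cong[where g="\<lambda>z. \<integral>\<^sup>+x. indicator G (F (z, x)) \<partial>X"]) auto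
  have m_half: "inverse 2 \<le> m z" and m_le: "m z \<le> 1" if z: "z \<in> space Z" for z
  proof -
    let ?\<eta> = "ennreal (1 / (2 * real N ^ 4))"
    have Qcard: "card Q \<le> N ^ 4"
      using card_mono[OF _ Qsub] by (simp add: card_cartesian_product power4_eq_xxxx mult.assoc)
    define B where "B = (\<lambda>(a, b, i, j). {x \<in> space X. dist (F (z, x) a i) (F (z, x) b j) < r})"
    have Bm: "B q \<in> sets X" if "q \<in> Q" for q
    proof -
      obtain a b i j where q: "q = (a, b, i, j)" "a < N" "b < N" "i < N" "j < N"
        using \<open>q \<in> Q\<close> unfolding Q_def by blast
      note [measurable] = wai[of a i] wai[of b j]
      show ?thesis
        using q z unfolding B_def by simp
    qed
    have comp: "emeasure X {x \<in> space X. dist (x b j) c < r} \<le> ?\<eta>" if b: "b \<in> I" "j < N" for b j and c :: 'a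
    proof -
      have [measurable]: "(\<lambda>y. y j) \<in> borel_measurable P"
        using b by (intro Pi)
      have "emeasure X {x \<in> space X. dist (x b j) c < r} = emeasure X {x \<in> space X. x b \<in> {y \<in> space P. dist (y j) c < r}}"
        using b by (intro arg_cong[where f="emeasure X"]) (auto simp: X_def space_PiM PiE_iff)
      also have "\<dots> = emeasure P {y \<in> space P. dist (y j) c < r}"
        unfolding X_def using b by (intro PP.emeasure_PiM_Collect_single) auto
      also have "\<dots> \<le> ?\<eta>"
        using close b by auto
      finally show ?thesis .
    qed
    have Bq: "emeasure X (B q) \<le> ?\<eta>" if "q \<in> Q" for q
    proof -
      obtain a b i j where q: "q = (a, b, i, j)" "a < N" "b < N" "i < N" "j < N" "a \<noteq> b"
        using \<open>q \<in> Q\<close> unfolding Q_def by blast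
      have "a \<in> I \<or> a = 0" "b \<in> I \<or> b = 0"
        using q(2,3) by (simp_all add: I_def, linarith+)
      \<comment> \<open>The rows differ, so at most one of them is row 0. If one is, its entry is a
        fixed centre and \<open>comp\<close> applies; otherwise both are independent samples of
        \<open>P\<close>.\<close>
      with q(6) consider "a = 0" "b \<in> I" | "b = 0" "a \<in> I" | "a \<in> I" "b \<in> I"
        by metis
      then show ?thesis
      proof cases
        case 1
        then show ?thesis
          using comp[of b j "z i"] q by (simp add: B_def F_def dist_commute)
      next
        case 2
        then show ?thesis
          using comp[of a i "z j"] q by (simp add: B_def F_def)
      next
        case 3
        have "emeasure X {x \<in> space X. dist (x a i) (x b j) < r} \<le> ?\<eta>"
          unfolding X_def using q 3 close[of i]
          by (intro emeasure_PiM_close[where f="\<lambda>y. y i" and g="\<lambda>y. y j"] P I Pi)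
        moreover have "a \<noteq> 0" "b \<noteq> 0"
          using 3 I(2) by metis+
        ultimately show ?thesis
          using q by (simp add: B_def F_def)
      qed
    qed
    have "emeasure X (\<Union>q\<in>Q. B q) \<le> (\<Sum>q\<in>Q. emeasure X (B q))"
      using Bm Qfin by (intro emeasure_subadditive_finite) auto
    also have "\<dots> \<le> (\<Sum>q\<in>Q. ?\<eta>)"
      using Bq by (rule sum_mono)
    also have "\<dots> = ennreal (real (card Q) * (1 / (2 * real N ^ 4)))"
      unfolding sum_constant ennreal_of_nat_eq_real_of_nat by (rule ennreal_mult'[symmetric]) simp
    also have "\<dots> \<le> ennreal (1 / 2)"
    proof (rule ennreal_leI)
      have "real (card Q) \<le> real N ^ 4"
        using Qcard by (metis of_nat_le_iff of_nat_power)
      then show "real (card Q) * (1 / (2 * real N ^ 4)) \<le> 1 / 2"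
        using N by (simp add: field_simps)
    qed
    finally have U: "emeasure X (\<Union>q\<in>Q. B q) \<le> ennreal (1/2)" .
    have UB: "(\<Union>q\<in>Q. B q) \<in> sets X"
      using Qfin Bm by (rule sets.finite_UN)
    have "(\<lambda>x. F (z, x)) \<in> measurable X ?W"
      using z by measurable
    then have GX: "{x \<in> space X. F (z, x) \<in> G} \<in> sets X"
      using G by measurable
    have "1 = emeasure X (space X)"
      by (simp add: X.emeasure_space_1)
    also have "\<dots> \<le> emeasure X ({x \<in> space X. F (z, x) \<in> G} \<union> (\<Union>q\<in>Q. B q))"
    proof (rule emeasure_mono)
      show "{x \<in> space X. F (z, x) \<in> G} \<union> (\<Union>q\<in>Q. B q) \<in> sets X"
        using GX UB by (rule sets.Un)
      show "space X \<subseteq> {x \<in> space X. F (z, x) \<in> G} \<union> (\<Union>q\<in>Q. B q)"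
      proof
        fix x assume x: "x \<in> space X"
        have sp: "F (z, x) \<in> space ?W"
          using x z measurable_space[OF F, of "(z, x)"] by (auto simp: space_pair_measure)
        show "x \<in> {x \<in> space X. F (z, x) \<in> G} \<union> (\<Union>q\<in>Q. B q)"
        proof (cases "well_separated r N (F (z, x))")
          case True
          then show ?thesis using sp x by (auto simp: G_def)
        next
          case False
          then obtain a b i j where "(a, b, i, j) \<in> Q" "dist (F (z, x) a i) (F (z, x) b j) < r"
            unfolding well_separated_def Q_def by (auto simp: not_le)
          then have "x \<in> B (a, b, i, j)"
            using x by (simp add: B_def)
          then show ?thesis
            using \<open>(a, b, i, j) \<in> Q\<close> by blast
        qed
      qed
    qed
    also have "\<dots> \<le> m z + emeasure X (\<Union>q\<in>Q. B q)"
      unfolding m_def by (rule emeasure_subadditive[OF GX UB])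
    also have "\<dots> \<le> m z + ennreal (1/2)"
      by (intro add_left_mono U)
    finally have *: "1 \<le> m z + ennreal (1/2)" .
    show "m z \<le> 1"
      unfolding m_def by (rule X.emeasure_le_1)
    define t where "t = measure X {x \<in> space X. F (z, x) \<in> G}"
    have t: "m z = ennreal t" "t \<ge> 0"
      unfolding m_def t_def X.emeasure_eq_measure by auto
    have "ennreal 1 \<le> ennreal (t + 1/2)"
      using * unfolding t(1) by (subst ennreal_plus) (simp_all add: t(2))
    then have "1 \<le> t + 1/2"
      using t(2) by (subst (asm) ennreal_le_iff) simp_all
    then have "ennreal (1/2) \<le> m z"
      unfolding t by (intro ennreal_leI) simp
    then show "inverse 2 \<le> m z"
      by simp
  qed
  \<comment> \<open>Since \<open>m z\<close> is at least 1/2, this density never exceeds 2, which is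
    the factor 2 in the bound for the rows other than row 0.\<close>
  define h where "h = (\<lambda>(z, x). indicator G (F (z, x)) * inverse (m z))"
  have h[measurable]: "h \<in> borel_measurable (Z \<Otimes>\<^sub>M X)"
    unfolding h_def case_prod_beta by measurable
  have h_le: "h p \<le> 2" if "p \<in> space (Z \<Otimes>\<^sub>M X)" for p
  proof (cases p)
    case (Pair z x)
    then have "inverse (m z) \<le> 2"
      using that m_half by (intro ennreal_inverse_le_2) (auto simp: space_pair_measure)
    then show ?thesis
      unfolding Pair h_def by (auto simp: indicator_def)
  qed
  define \<Theta> where "\<Theta> = density (Z \<Otimes>\<^sub>M X) h"
  define \<Lambda> where "\<Lambda> = distr \<Theta> ?W F"
  have F'[measurable]: "F \<in> measurable \<Theta> ?W"
    unfolding \<Theta>_def by simp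
  \<comment> \<open>Integrating \<open>h (z, x)\<close> over \<open>x\<close> gives
    \<open>m z * inverse (m z)\<close>, which is 1, so the first marginal of \<open>\<Theta>\<close>
    is still \<open>Z\<close>.\<close>
  have Z_marg: "(\<integral>\<^sup>+p. g (fst p) \<partial>\<Theta>) = (\<integral>\<^sup>+z. g z \<partial>Z)" if [measurable]: "g \<in> borel_measurable Z" for g
  proof -
    have "(\<integral>\<^sup>+p. g (fst p) \<partial>\<Theta>) = (\<integral>\<^sup>+p. h p * g (fst p) \<partial>(Z \<Otimes>\<^sub>M X))"
      unfolding \<Theta>_def by (subst nn_integral_density) auto
    also have "\<dots> = (\<integral>\<^sup>+z. (\<integral>\<^sup>+x. h (z, x) * g z \<partial>X) \<partial>Z)"
      by (subst X.nn_integral_fst[symmetric]) auto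
    also have "\<dots> = (\<integral>\<^sup>+z. g z \<partial>Z)"
    proof (rule nn_integral_cong)
      fix z assume z: "z \<in> space Z"
      have "(\<integral>\<^sup>+x. h (z, x) * g z \<partial>X) = (\<integral>\<^sup>+x. indicator G (F (z, x)) * (inverse (m z) * g z) \<partial>X)"
        by (simp add: h_def mult.assoc)
      also have "\<dots> = m z * (inverse (m z) * g z)"
        using z by (subst nn_integral_multc) (auto simp: m_alt)
      also have "m z * (inverse (m z) * g z) = g z"
      proof -
        have "m z \<noteq> 0" "m z \<noteq> \<top>"
          using m_half[OF z] m_le[OF z] by (auto simp: top_unique)
        then have "m z * inverse (m z) = 1"
          using ennreal_divide_self[of "m z"] by (simp add: divide_ennreal_def less_top)
        then show ?thesis
          by (simp flip: mult.assoc)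
      qed
      finally show "(\<integral>\<^sup>+x. h (z, x) * g z \<partial>X) = g z" .
    qed
    finally show ?thesis .
  qed
  show thesis
  proof
    show "sets \<Lambda> = sets ?W"
      by (simp add: \<Lambda>_def)
    have "emeasure \<Theta> (space \<Theta>) = (\<integral>\<^sup>+p. 1 \<partial>\<Theta>)"
      by simp
    also have "\<dots> = 1"
      using Z_marg[of "\<lambda>_. 1"] by (simp add: Z.emeasure_space_1)
    finally interpret \<Theta>: prob_space \<Theta>
      by (rule prob_spaceI)
    show "prob_space \<Lambda>"
      unfolding \<Lambda>_def by (rule \<Theta>.prob_space_distr) measurable
    have "F p \<in> G" if "0 < h p" for p
      using that by (cases p; cases "F p \<in> G") (simp_all add: h_def)
    then have "AE p in \<Theta>. F p \<in> G"
      unfolding \<Theta>_def by (subst AE_density) auto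
    then show "AE w in \<Lambda>. well_separated r N w"
      unfolding \<Lambda>_def using G by (subst AE_distr_iff) (auto simp: G_def elim!: AE_mp)
    show "emeasure (distr \<Lambda> E (\<lambda>w. w 0)) A = emeasure Z A" if A: "A \<in> sets E" for A
    proof -
      note A[measurable]
      have "A \<in> sets Z"
        unfolding Z(2) by (rule A)
      have [measurable]: "(\<lambda>w. w 0) \<in> measurable ?W E"
        using N by (intro measurable_component_singleton) auto
      have "distr \<Lambda> E (\<lambda>w. w 0) = distr \<Theta> E (\<lambda>p. F p 0)"
        unfolding \<Lambda>_def by (simp add: distr_distr comp_def)
      also have "\<dots> = distr \<Theta> E fst"
        by (simp add: F_def case_prod_beta)
      finally have "emeasure (distr \<Lambda> E (\<lambda>w. w 0)) A = (\<integral>\<^sup>+y. indicator A y \<partial>distr \<Theta> E fst)"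
        by simp
      also have "\<dots> = (\<integral>\<^sup>+p. indicator A (fst p) \<partial>\<Theta>)"
        unfolding \<Theta>_def by (subst nn_integral_distr) auto
      also have "\<dots> = emeasure Z A"
        using Z_marg[of "indicator A"] \<open>A \<in> sets Z\<close> by simp
      finally show ?thesis .
    qed
    show "emeasure (distr \<Lambda> E (\<lambda>w. w a)) A \<le> 2 * emeasure P A"
      if a: "1 \<le> a" "a < N" and A: "A \<in> sets E" for a A
    proof -
      note A[measurable]
      have aI: "a \<in> I" "a \<noteq> 0" "a \<in> {..<N}"
        using a unfolding I_def atLeastLessThan_iff lessThan_iff by linarith+
      have [measurable]: "(\<lambda>w. w a) \<in> measurable ?W E"
        by (rule measurable_component_singleton[OF aI(3)])
      have [measurable]: "(\<lambda>x. x a) \<in> measurable X P"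
        unfolding X_def by (rule measurable_component_singleton[OF aI(1)])
      then have [measurable]: "(\<lambda>x. x a) \<in> measurable X E"
        by (simp cong: measurable_cong_sets add: P(2))
      have [measurable]: "A \<in> sets P"
        unfolding P(2) by (rule A)
      have "distr X P (\<lambda>x. x a) = P"
        unfolding X_def by (rule PP.PiM_component[OF aI(1)])
      then have PX: "(\<integral>\<^sup>+x. indicator A (x a) \<partial>X) = emeasure P A"
        using nn_integral_distr[of "\<lambda>x. x a" X P "indicator A"] by simp
      have "distr \<Lambda> E (\<lambda>w. w a) = distr \<Theta> E (\<lambda>p. F p a)"
        unfolding \<Lambda>_def by (simp add: distr_distr comp_def)
      also have "\<dots> = distr \<Theta> E (\<lambda>p. snd p a)"
        using a by (simp add: F_def case_prod_beta)
      finally have "emeasure (distr \<Lambda> E (\<lambda>w. w a)) A = (\<integral>\<^sup>+y. indicator A y \<partial>distr \<Theta> E (\<lambda>p. snd p a))"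
        by simp
      also have "\<dots> = (\<integral>\<^sup>+p. indicator A (snd p a) \<partial>\<Theta>)"
        unfolding \<Theta>_def by (subst nn_integral_distr) auto
      also have "\<dots> = (\<integral>\<^sup>+p. h p * indicator A (snd p a) \<partial>(Z \<Otimes>\<^sub>M X))"
        unfolding \<Theta>_def by (subst nn_integral_density) auto
      also have "\<dots> \<le> (\<integral>\<^sup>+p. 2 * indicator A (snd p a) \<partial>(Z \<Otimes>\<^sub>M X))"
        by (intro nn_integral_mono mult_right_mono h_le) auto
      also have "\<dots> = (\<integral>\<^sup>+z. (\<integral>\<^sup>+x. 2 * indicator A (x a) \<partial>X) \<partial>Z)"
        using X.nn_integral_fst[of "\<lambda>p. 2 * indicator A (snd p a)" Z] by simp
      also have "\<dots> = 2 * emeasure P A"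
        by (simp add: Z.emeasure_space_1 nn_integral_cmult PX)
      finally show ?thesis .
    qed
  qed
qed

text \<open>Read in two ways: for a fixed column the \<open>N\<close> diagonals meet each row once,
  and along a fixed diagonal different columns lie in different rows. Equal residues would make
  \<open>N\<close> divide a smaller positive number.\<close>

lemma bij_betw_shift_mod:
  fixes i N :: nat
  shows "bij_betw (\<lambda>k. (i + k) mod N) {..<N} {..<N}"
proof -
  have le: "k = l" if "k \<le> l" "l < N" "(i + k) mod N = (i + l) mod N" for k l
  proof -
    have "N dvd (i + l) - (i + k)"
      using that by (subst mod_eq_dvd_iff_nat[symmetric]) auto
    then have "N dvd l - k"
      by simp
    then show ?thesis
      using that dvd_imp_le[of N "l - k"] by (cases "l - k = 0") auto
  qed
  have "inj_on (\<lambda>k. (i + k) mod N) {..<N}"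
  proof (rule inj_onI)
    fix k l assume "k \<in> {..<N}" "l \<in> {..<N}" "(i + k) mod N = (i + l) mod N"
    then show "k = l"
      using le[of k l] le[of l k] by (cases "k \<le> l") auto
  qed
  moreover have "(\<lambda>k. (i + k) mod N) ` {..<N} \<subseteq> {..<N}"
    by auto
  ultimately show ?thesis
    unfolding bij_betw_def by (simp add: endo_inj_surj)
qed

section \<open>Configurations, the cost, and the exchange step\<close>

abbreviation config :: "nat \<Rightarrow> (nat \<Rightarrow> 'a::euclidean_space) measure" where
  "config N \<equiv> Pi\<^sub>M {..<N} (\<lambda>_. borel)"

abbreviation cyl :: "nat \<Rightarrow> nat \<Rightarrow> 'a::euclidean_space set \<Rightarrow> (nat \<Rightarrow> 'a) set" where
  "cyl N i A \<equiv> {x \<in> space (config N). x i \<in> A}"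

lemma cyl_sets:
  assumes "i < N" "A \<in> sets borel"
  shows "cyl N i A \<in> sets (config N :: (nat \<Rightarrow> 'a::euclidean_space) measure)"
  using assms by (intro sets_Collect_single') auto

locale repulsive_cost =
  fixes \<phi> :: "real \<Rightarrow> real" and N :: nat
  assumes N: "1 < N"
    and cont: "continuous_on {0<..} \<phi>"
    and antimono: "\<And>s t. 0 < s \<Longrightarrow> s \<le> t \<Longrightarrow> \<phi> t \<le> \<phi> s"
    and nonneg: "\<And>t. 0 < t \<Longrightarrow> 0 \<le> \<phi> t"
begin

text \<open>\<open>\<phi>\<close> is continuous only on positive arguments. Cutting off the origin
  by an indicator gives a Borel function, and the value infinity is then inserted at that single
  point.\<close>

lemma phi_ext_measurable:
  "(\<lambda>v::'a::euclidean_space. phi_ext \<phi> (norm v)) \<in> borel_measurable borel"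
proof -
  have "continuous_on (- {0}) (\<lambda>v::'a. \<phi> (norm v))"
    by (intro continuous_on_compose2[OF cont] continuous_intros) auto
  then have "(\<lambda>v::'a. indicator (- {0}) v *\<^sub>R \<phi> (norm v)) \<in> borel_measurable borel"
    by (intro borel_measurable_continuous_on_indicator) auto
  then have "(\<lambda>v::'a. if v = 0 then \<infinity> else ennreal (indicator (- {0}) v *\<^sub>R \<phi> (norm v))) \<in> borel_measurable borel"
    by measurable
  also have "(\<lambda>v::'a. if v = 0 then \<infinity> else ennreal (indicator (- {0}) v *\<^sub>R \<phi> (norm v)))
      = (\<lambda>v. phi_ext \<phi> (norm v))"
    by (auto simp: phi_ext_def fun_eq_iff)
  finally show ?thesis .
qed

lemma cost_measurable:
  "cost \<phi> N \<in> borel_measurable (config N :: (nat \<Rightarrow> 'a::euclidean_space) measure)"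
proof -
  have "(\<lambda>x. phi_ext \<phi> (norm (x i - x j))) \<in> borel_measurable (config N :: (nat \<Rightarrow> 'a) measure)"
    if "i < N" "j < N" for i j
    using that by (intro measurable_compose[OF _ phi_ext_measurable] borel_measurable_diff measurable_component_singleton) auto
  then have "(\<lambda>x. \<Sum>j<N. \<Sum>i<j. phi_ext \<phi> (norm (x i - x j))) \<in> borel_measurable (config N :: (nat \<Rightarrow> 'a) measure)"
    by (intro borel_measurable_sum) auto
  then show ?thesis
    by (simp add: cost_def[abs_def])
qed

text \<open>By monotonicity each pair costs at most \<open>\<phi> r\<close>; counting all
  \<open>N ^ 2\<close> index pairs is crude but keeps the constant simple.\<close>

lemma cost_le:
  fixes x :: "nat \<Rightarrow> 'a::euclidean_space"
  assumes r: "0 < r" and sep: "\<And>i j. i < N \<Longrightarrow> j < N \<Longrightarrow> i \<noteq> j \<Longrightarrow> r \<le> dist (x i) (x j)"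
  shows "cost \<phi> N x \<le> ennreal (real N ^ 2 * \<phi> r)"
proof -
  have *: "phi_ext \<phi> (norm (x i - x j)) \<le> ennreal (\<phi> r)" if "i < j" "j < N" for i j
  proof -
    have "r \<le> norm (x i - x j)"
      using sep[of i j] that by (simp add: dist_norm)
    then show ?thesis
      using antimono[of r "norm (x i - x j)"] r by (auto simp: phi_ext_def intro!: ennreal_leI)
  qed
  have "cost \<phi> N x \<le> (\<Sum>j<N. \<Sum>i<j. ennreal (\<phi> r))"
    unfolding cost_def by (intro sum_mono *) auto
  also have "\<dots> \<le> (\<Sum>j<N. \<Sum>i<N. ennreal (\<phi> r))"
    by (intro sum_mono sum_mono2) auto
  also have "\<dots> = ennreal (real N ^ 2 * \<phi> r)"
    using nonneg[OF r]
    by (simp add: power2_eq_square ennreal_mult' mult.assoc ennreal_of_nat_eq_real_of_nat)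
  finally show ?thesis .
qed

text \<open>The exchange step in terms of measures. With weight \<open>\<delta>\<close>, the laws of
  rows 1 to \<open>N - 1\<close> are removed from \<open>P\<close> and the laws of the
  \<open>N\<close> diagonals are added. Each diagonal costs at most
  \<open>real N ^ 2 * \<phi> r\<close>, so together they cost at most
  \<open>real N ^ 3 * \<phi> r * \<delta>\<close>. The smallness of \<open>\<delta>\<close> ensures
  that \<open>P\<close> contains what is removed.\<close>

lemma augment:
  fixes P :: "(nat \<Rightarrow> 'a::euclidean_space) measure" and \<nu> :: "nat \<Rightarrow> 'a measure"
  assumes P: "sets P = sets (config N)" "emeasure P (space P) = ennreal s"
    and \<delta>: "0 < \<delta>" "2 * real N * \<delta> \<le> s" and r: "0 < r"
    and \<nu>: "\<And>i. i < N \<Longrightarrow> sets (\<nu> i) = sets borel" "\<And>i. i < N \<Longrightarrow> emeasure (\<nu> i) UNIV = ennreal \<delta>"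
    and close: "\<And>j z. j < N \<Longrightarrow> emeasure P (cyl N j (ball z r)) \<le> ennreal (s / (2 * real N ^ 4))"
  obtains Q :: "(nat \<Rightarrow> 'a) measure" where "sets Q = sets (config N)"
    "\<And>i A. i < N \<Longrightarrow> A \<in> sets borel \<Longrightarrow> emeasure Q (cyl N i A) = emeasure P (cyl N i A) + emeasure (\<nu> i) A"
    "(\<integral>\<^sup>+x. cost \<phi> N x \<partial>Q) \<le> (\<integral>\<^sup>+x. cost \<phi> N x \<partial>P) + ennreal (real N ^ 3 * \<phi> r * \<delta>)"
proof -
  let ?E = "config N :: (nat \<Rightarrow> 'a) measure"
  have "0 < 2 * real N * \<delta>"
    using N \<delta> by simp
  with \<delta> have s: "0 < s"
    by linarith
  have spP: "space P = space ?E"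
    using P(1) by (rule sets_eq_imp_space_eq)
  define P1 where "P1 = scale_measure (ennreal (1 / s)) P"
  have P1_sets: "sets P1 = sets ?E"
    by (simp add: P1_def P)
  have P1: "prob_space P1"
    by (rule prob_spaceI)
      (use s in \<open>simp add: P1_def space_scale_measure P(2) ennreal_mult'[symmetric]\<close>)
  \<comment> \<open>How the missing marginals are coupled within row 0 is immaterial, since only its
    one-point marginals enter the argument; the product is the simplest coupling.\<close>
  define Z where "Z = PiM {..<N} (\<lambda>i. scale_measure (ennreal (1 / \<delta>)) (\<nu> i))"
  have Zi: "prob_space (scale_measure (ennreal (1 / \<delta>)) (\<nu> i))" if "i < N" for i
  proof (rule prob_spaceI)
    have "space (\<nu> i) = UNIV"
      using sets_eq_imp_space_eq[OF \<nu>(1)[OF that]] by simp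
    then show "emeasure (scale_measure (ennreal (1 / \<delta>)) (\<nu> i))
        (space (scale_measure (ennreal (1 / \<delta>)) (\<nu> i))) = 1"
      using \<delta> \<nu>(2)[OF that] by (simp add: space_scale_measure ennreal_mult'[symmetric])
  qed
  have Z: "prob_space Z"
    unfolding Z_def by (rule prob_space_PiM) (use Zi in auto)
  have Z_sets: "sets Z = sets ?E"
    unfolding Z_def by (rule sets_PiM_cong) (auto simp: \<nu>)
  have Z_cyl: "emeasure Z (cyl N i A) = ennreal (1 / \<delta>) * emeasure (\<nu> i) A"
    if i: "i < N" and A: "A \<in> sets borel" for i A
  proof -
    have spZ: "space Z = space ?E"
      using Z_sets by (rule sets_eq_imp_space_eq)
    have "distr Z (scale_measure (ennreal (1 / \<delta>)) (\<nu> i)) (\<lambda>x. x i) = scale_measure (ennreal (1 / \<delta>)) (\<nu> i)"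
      unfolding Z_def using i by (intro distr_PiM_component Zi) auto
    then have "ennreal (1 / \<delta>) * emeasure (\<nu> i) A
        = emeasure (distr Z (scale_measure (ennreal (1 / \<delta>)) (\<nu> i)) (\<lambda>x. x i)) A"
      by simp
    also have "\<dots> = emeasure Z ((\<lambda>x. x i) -` A \<inter> space Z)"
      using i A \<nu>(1)[OF i] by (intro emeasure_distr) (auto simp: Z_def intro!: measurable_component_singleton)
    also have "(\<lambda>x. x i) -` A \<inter> space Z = cyl N i A"
      by (auto simp: spZ)
    finally show ?thesis ..
  qed
  have close1: "emeasure P1 {y \<in> space P1. dist (y j) z < r} \<le> ennreal (1 / (2 * real N ^ 4))" if "j < N" for j z
  proof -
    have "{y \<in> space P1. dist (y j) z < r} = cyl N j (ball z r)"
      by (auto simp: P1_def space_scale_measure spP dist_commute)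
    then have "emeasure P1 {y \<in> space P1. dist (y j) z < r} = ennreal (1 / s) * emeasure P (cyl N j (ball z r))"
      by (simp add: P1_def)
    also have "\<dots> \<le> ennreal (1 / s) * ennreal (s / (2 * real N ^ 4))"
      by (intro mult_left_mono close that) simp
    also have "\<dots> = ennreal (1 / (2 * real N ^ 4))"
      using s by (subst ennreal_mult'[symmetric]) auto
    finally show ?thesis .
  qed
  from N have N0: "0 < N"
    by simp
  obtain \<Lambda> :: "(nat \<Rightarrow> nat \<Rightarrow> 'a) measure" where \<Lambda>: "prob_space \<Lambda>"
    and \<Lambda>_sets: "sets \<Lambda> = sets (PiM {..<N} (\<lambda>_. ?E))"
    and sep: "AE w in \<Lambda>. well_separated r N w"
    and \<Lambda>0: "\<And>A. A \<in> sets ?E \<Longrightarrow> emeasure (distr \<Lambda> ?E (\<lambda>w. w 0)) A = emeasure Z A"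
    and \<Lambda>a: "\<And>a A. 1 \<le> a \<Longrightarrow> a < N \<Longrightarrow> A \<in> sets ?E \<Longrightarrow> emeasure (distr \<Lambda> ?E (\<lambda>w. w a)) A \<le> 2 * emeasure P1 A"
    by (rule conditioned_sample[OF refl P1 P1_sets Z Z_sets N0 close1]) blast+
  interpret \<Lambda>: prob_space \<Lambda> by (rule \<Lambda>)
  have wa: "(\<lambda>w. w a) \<in> measurable \<Lambda> ?E" if "a < N" for a
    unfolding measurable_cong_sets[OF \<Lambda>_sets refl]
    using that by (intro measurable_component_singleton) simp
  have wai: "(\<lambda>w. w a i) \<in> borel_measurable \<Lambda>" if "a < N" "i < N" for a i
    using that by (intro measurable_compose[OF wa measurable_component_singleton]) auto
  define q where "q a i A = emeasure \<Lambda> {w \<in> space \<Lambda>. w a i \<in> A}" for a i A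
  have q: "emeasure (distr \<Lambda> ?E (\<lambda>w. w a)) (cyl N i A) = q a i A"
    if "a < N" "i < N" "A \<in> sets borel" for a i A
  proof -
    have "emeasure (distr \<Lambda> ?E (\<lambda>w. w a)) (cyl N i A) = emeasure \<Lambda> ((\<lambda>w. w a) -` cyl N i A \<inter> space \<Lambda>)"
      using that by (intro emeasure_distr wa cyl_sets)
    also have "(\<lambda>w. w a) -` cyl N i A \<inter> space \<Lambda> = {w \<in> space \<Lambda>. w a i \<in> A}"
      using measurable_space[OF wa[OF that(1)]] by auto
    finally show ?thesis
      by (simp add: q_def)
  qed
  define R where "R = sum_measure ?E {1..<N} (\<lambda>a. scale_measure (ennreal \<delta>) (distr \<Lambda> ?E (\<lambda>w. w a)))"
  have R_sets: "sets R = sets ?E"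
    by (simp add: R_def)
  have R_em: "emeasure R A = (\<Sum>a\<in>{1..<N}. ennreal \<delta> * emeasure (distr \<Lambda> ?E (\<lambda>w. w a)) A)" if "A \<in> sets ?E" for A
    unfolding R_def using that by (subst emeasure_sum_measure) auto
  \<comment> \<open>Each row law is at most \<open>2 / s\<close> times \<open>P\<close>, and
    \<open>N - 1\<close> of them are taken with weight \<open>\<delta>\<close>; the hypothesis
    \<open>2 * real N * \<delta> \<le> s\<close> makes the total factor at most 1.\<close>
  have R_le: "emeasure R A \<le> emeasure P A" if A: "A \<in> sets ?E" for A
  proof -
    have "emeasure R A \<le> (\<Sum>a\<in>{1..<N}. ennreal \<delta> * (2 * (ennreal (1 / s) * emeasure P A)))"
      unfolding R_em[OF A] using \<Lambda>a[OF _ _ A] by (intro sum_mono mult_left_mono) (auto simp: P1_def)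
    also have "\<dots> = ennreal (real (N - 1)) * (ennreal \<delta> * (ennreal 2 * (ennreal (1 / s) * emeasure P A)))"
      by (simp add: ennreal_of_nat_eq_real_of_nat)
    also have "\<dots> = ennreal (real (N - 1) * (\<delta> * (2 * (1 / s)))) * emeasure P A"
      using s \<delta> by (simp only: ennreal_mult' mult.assoc of_nat_0_le_iff zero_le_numeral less_imp_le)
    also have "\<dots> \<le> ennreal 1 * emeasure P A"
    proof (intro mult_right_mono ennreal_leI)
      have "real (N - 1) * (\<delta> * 2) \<le> real N * (\<delta> * 2)"
        using \<delta> by (intro mult_right_mono) auto
      also have "\<dots> \<le> s"
        using \<delta>(2) by (simp add: mult_ac)
      finally show "real (N - 1) * (\<delta> * (2 * (1 / s))) \<le> 1"
        using s by (simp add: field_simps)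
    qed simp
    finally show ?thesis
      by simp
  qed
  have P_fin: "finite_measure P"
    by (rule finite_measureI) (simp add: P(2))
  have R_fin: "finite_measure R"
  proof (rule finite_measureI)
    have "emeasure R (space R) \<le> ennreal s"
      using R_le[of "space ?E"] P(2) by (simp add: R_def spP)
    then show "emeasure R (space R) \<noteq> \<infinity>"
      by (auto simp: top_unique)
  qed
  define D where "D = diff_measure P R"
  have D_sets: "sets D = sets ?E"
    by (simp add: D_def P)
  have D_em: "emeasure D A = emeasure P A - emeasure R A" if "A \<in> sets ?E" for A
    unfolding D_def using that R_le P_fin R_fin
    by (intro emeasure_diff_measure) (auto simp: P(1) R_sets)
  define Y where "Y k w = (\<lambda>i\<in>{..<N}. w ((i + k) mod N) i)" for k and w :: "nat \<Rightarrow> nat \<Rightarrow> 'a"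
  have Y: "Y k \<in> measurable \<Lambda> ?E" for k
    unfolding Y_def using N0 by (intro measurable_restrict wai) auto
  \<comment> \<open>Indices below \<open>N\<close> carry the cyclic diagonals, and the extra index
    \<open>N\<close> carries what is left of \<open>P\<close>; this is why \<open>Q\<close> sums
    over \<open>{..N}\<close>.\<close>
  define T where "T k = (if k < N then scale_measure (ennreal \<delta>) (distr \<Lambda> ?E (Y k)) else D)" for k
  define Q where "Q = sum_measure ?E {..N} T"
  have T_sets: "sets (T k) = sets ?E" for k
    by (simp add: T_def D_sets)
  have split_N: "(\<Sum>k\<le>N. f k) = (\<Sum>k<N. f k) + f N" for f :: "nat \<Rightarrow> ennreal"
    using lessThan_Suc_atMost[of N] by (metis sum.lessThan_Suc)
  show thesis
  proof
    show "sets Q = sets ?E"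
      by (simp add: Q_def)
    show "emeasure Q (cyl N i A) = emeasure P (cyl N i A) + emeasure (\<nu> i) A"
      if i: "i < N" and A: "A \<in> sets borel" for i A
    proof -
      have cyl: "cyl N i A \<in> sets ?E"
        using i A by (rule cyl_sets)
      have Tk: "emeasure (T k) (cyl N i A) = ennreal \<delta> * q ((i + k) mod N) i A" if "k < N" for k
      proof -
        have "Y k -` cyl N i A \<inter> space \<Lambda> = {w \<in> space \<Lambda>. w ((i + k) mod N) i \<in> A}"
          using i measurable_space[OF Y[of k]] by (auto simp: Y_def)
        then show ?thesis
          using that cyl Y by (simp add: T_def emeasure_distr q_def)
      qed
      have Rq: "emeasure R (cyl N i A) = (\<Sum>a\<in>{1..<N}. ennreal \<delta> * q a i A)"
        unfolding R_em[OF cyl] using q i A by (intro sum.cong) auto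
      have q0: "ennreal \<delta> * q 0 i A = emeasure (\<nu> i) A"
      proof -
        have "q 0 i A = ennreal (1 / \<delta>) * emeasure (\<nu> i) A"
          using q[OF N0 i A] \<Lambda>0[OF cyl] Z_cyl[OF i A] by simp
        then have "ennreal \<delta> * q 0 i A = (ennreal \<delta> * ennreal (1 / \<delta>)) * emeasure (\<nu> i) A"
          by (simp only: mult.assoc)
        also have "ennreal \<delta> * ennreal (1 / \<delta>) = 1"
          using \<delta> by (subst ennreal_mult'[symmetric]) auto
        finally show ?thesis by simp
      qed
      have "{..<N} = insert 0 {1..<N}"
        using N0 by auto
      then have ins: "(\<Sum>a<N. f a) = f 0 + (\<Sum>a\<in>{1..<N}. f a)" for f :: "nat \<Rightarrow> ennreal"
        by simp
      have "(\<Sum>k<N. emeasure (T k) (cyl N i A)) = (\<Sum>k<N. ennreal \<delta> * q ((i + k) mod N) i A)"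
        by (intro sum.cong refl Tk) simp
      \<comment> \<open>In column \<open>i\<close> the diagonals run once through all rows. Rows 1
        to \<open>N - 1\<close> give back the marginal of \<open>R\<close>, and row 0 supplies
        \<open>\<nu> i\<close>.\<close>
      also have "\<dots> = (\<Sum>a<N. ennreal \<delta> * q a i A)"
        by (rule sum.reindex_bij_betw[OF bij_betw_shift_mod])
      also have "\<dots> = emeasure (\<nu> i) A + emeasure R (cyl N i A)"
        unfolding ins Rq q0 ..
      finally have S: "(\<Sum>k<N. emeasure (T k) (cyl N i A)) = emeasure (\<nu> i) A + emeasure R (cyl N i A)" .
      have "emeasure Q (cyl N i A) = (\<Sum>k<N. emeasure (T k) (cyl N i A)) + emeasure D (cyl N i A)"
        unfolding Q_def using T_sets cyl by (subst emeasure_sum_measure) (auto simp: split_N T_def)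
      also have "\<dots> = emeasure (\<nu> i) A + (emeasure R (cyl N i A) + (emeasure P (cyl N i A) - emeasure R (cyl N i A)))"
        unfolding S D_em[OF cyl] by (simp only: add.assoc)
      \<comment> \<open>The truncated subtraction cancels because \<open>R\<close> is dominated by
        \<open>P\<close>.\<close>
      also have "\<dots> = emeasure (\<nu> i) A + emeasure P (cyl N i A)"
        by (subst add_diff_inverse_ennreal[OF R_le[OF cyl]]) simp
      finally show ?thesis
        by (simp add: add.commute)
    qed
    have Y_cost: "(\<integral>\<^sup>+x. cost \<phi> N x \<partial>T k) \<le> ennreal (\<delta> * (real N ^ 2 * \<phi> r))" if k: "k < N" for k
    proof -
      have "AE w in \<Lambda>. cost \<phi> N (Y k w) \<le> ennreal (real N ^ 2 * \<phi> r)"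
        using sep
      proof eventually_elim
        fix w :: "nat \<Rightarrow> nat \<Rightarrow> 'a" assume w: "well_separated r N w"
        show "cost \<phi> N (Y k w) \<le> ennreal (real N ^ 2 * \<phi> r)"
        proof (rule cost_le[OF r])
          fix i j assume ij: "i < N" "j < N" "i \<noteq> j"
          have "inj_on (\<lambda>i. (k + i) mod N) {..<N}"
            using bij_betw_shift_mod[of k N] by (simp add: bij_betw_def)
          then have "(i + k) mod N \<noteq> (j + k) mod N"
            using inj_on_contraD[of "\<lambda>i. (k + i) mod N" "{..<N}" i j] ij by (simp add: add.commute[of k])
          then show "r \<le> dist (Y k w i) (Y k w j)"
            using w ij N0 by (simp add: well_separated_def Y_def)
        qed
      qed
      then have "(\<integral>\<^sup>+w. cost \<phi> N (Y k w) \<partial>\<Lambda>) \<le> (\<integral>\<^sup>+w. ennreal (real N ^ 2 * \<phi> r) \<partial>\<Lambda>)"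
        by (rule nn_integral_mono_AE)
      then have "(\<integral>\<^sup>+w. cost \<phi> N (Y k w) \<partial>\<Lambda>) \<le> ennreal (real N ^ 2 * \<phi> r)"
        by (simp add: \<Lambda>.emeasure_space_1)
      moreover have "(\<integral>\<^sup>+x. cost \<phi> N x \<partial>T k) = ennreal \<delta> * (\<integral>\<^sup>+w. cost \<phi> N (Y k w) \<partial>\<Lambda>)"
      proof -
        have cm: "cost \<phi> N \<in> borel_measurable (distr \<Lambda> ?E (Y k))"
          by (simp add: cost_measurable)
        show ?thesis
          using k nn_integral_scale_measure[OF cm, of "ennreal \<delta>"] nn_integral_distr[OF Y[of k] cm]
          by (simp add: T_def)
      qed
      ultimately show ?thesis
        using \<delta> by (simp add: ennreal_mult' mult_left_mono)
    qed
    have "(\<integral>\<^sup>+x. cost \<phi> N x \<partial>D) \<le> (\<integral>\<^sup>+x. cost \<phi> N x \<partial>P)"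
      by (rule nn_integral_mono_measure)
        (auto simp: D_sets P(1) D_em le_measure diff_le_self_ennreal)
    moreover have "(\<Sum>k<N. \<integral>\<^sup>+x. cost \<phi> N x \<partial>T k) \<le> ennreal (real N ^ 3 * \<phi> r * \<delta>)"
    proof -
      have "(\<Sum>k<N. \<integral>\<^sup>+x. cost \<phi> N x \<partial>T k) \<le> (\<Sum>k<N. ennreal (\<delta> * (real N ^ 2 * \<phi> r)))"
        by (intro sum_mono Y_cost) simp
      also have "\<dots> = ennreal (real N * (\<delta> * (real N ^ 2 * \<phi> r)))"
        by (simp add: ennreal_of_nat_eq_real_of_nat ennreal_mult')
      also have "real N * (\<delta> * (real N ^ 2 * \<phi> r)) = real N ^ 3 * \<phi> r * \<delta>"
        by (simp add: power2_eq_square power3_eq_cube)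
      finally show ?thesis .
    qed
    moreover have "(\<integral>\<^sup>+x. cost \<phi> N x \<partial>Q) = (\<Sum>k<N. \<integral>\<^sup>+x. cost \<phi> N x \<partial>T k) + (\<integral>\<^sup>+x. cost \<phi> N x \<partial>D)"
      unfolding Q_def using T_sets cost_measurable
      by (subst nn_integral_sum_measure) (auto simp: split_N T_def)
    ultimately show "(\<integral>\<^sup>+x. cost \<phi> N x \<partial>Q) \<le> (\<integral>\<^sup>+x. cost \<phi> N x \<partial>P) + ennreal (real N ^ 3 * \<phi> r * \<delta>)"
      by (metis add.commute add_mono)
  qed
qed

end

section \<open>Completing sub-plans, and finiteness of the cost\<close>

context repulsive_cost
begin

lemma transport_plansI:
  fixes Q :: "(nat \<Rightarrow> 'a::euclidean_space) measure"
  assumes Q: "sets Q = sets (config N)" and \<rho>: "sets \<rho> = sets borel" "prob_space \<rho>"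
    and marg: "\<And>i A. i < N \<Longrightarrow> A \<in> sets borel \<Longrightarrow> emeasure Q (cyl N i A) = emeasure \<rho> A"
  shows "Q \<in> transport_plans N \<rho>"
proof -
  interpret \<rho>: prob_space \<rho> by fact
  have sp: "space Q = space (config N)" "space \<rho> = UNIV"
    using sets_eq_imp_space_eq[OF Q] sets_eq_imp_space_eq[OF \<rho>(1)] by auto
  have "emeasure Q (space Q) = 1"
    using marg[of 0 UNIV] N \<rho>.emeasure_space_1 sp by simp
  then have "prob_space Q"
    by (rule prob_spaceI)
  moreover have "distr Q borel (\<lambda>x. x i) = \<rho>" if i: "i < N" for i
  proof (rule measure_eqI)
    show "sets (distr Q borel (\<lambda>x. x i)) = sets \<rho>"
      by (simp add: \<rho>)
    fix A :: "'a set" assume "A \<in> sets (distr Q borel (\<lambda>x. x i))"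
    then have A: "A \<in> sets borel"
      by simp
    have m: "(\<lambda>x. x i) \<in> borel_measurable Q"
      using i by (subst measurable_cong_sets[OF Q refl]) (simp add: measurable_component_singleton)
    have "emeasure (distr Q borel (\<lambda>x. x i)) A = emeasure Q (cyl N i A)"
      unfolding emeasure_distr[OF m A] by (rule arg_cong[where f="emeasure Q"]) (auto simp: sp)
    then show "emeasure (distr Q borel (\<lambda>x. x i)) A = emeasure \<rho> A"
      using marg[OF i A] by simp
  qed
  ultimately show ?thesis
    using Q by (simp add: transport_plans_def)
qed

text \<open>The missing mass \<open>1 - s\<close> can be too large for a single use of
  \<open>augment\<close>, so it is added in \<open>2 * N\<close> equal portions, by induction on the
  number of portions already added. The extra costs are proportional to the portions and sum to a
  multiple of \<open>1 - s\<close>.\<close>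

lemma complete_plan:
  fixes P :: "(nat \<Rightarrow> 'a::euclidean_space) measure"
  assumes P: "sets P = sets (config N)" "emeasure P (space P) = ennreal s"
    and s: "1 / 2 \<le> s" "s \<le> 1" and r: "0 < r"
    and \<rho>: "sets \<rho> = sets borel" "prob_space \<rho>"
    and dom: "\<And>i A. i < N \<Longrightarrow> A \<in> sets borel \<Longrightarrow> emeasure P (cyl N i A) \<le> emeasure \<rho> A"
    and close: "\<And>z. emeasure \<rho> (ball z r) \<le> ennreal (1 / (4 * real N ^ 4))"
  shows "transport_cost \<phi> N \<rho> \<le> (\<integral>\<^sup>+x. cost \<phi> N x \<partial>P) + ennreal (real N ^ 3 * \<phi> r * (1 - s))"
proof -
  interpret \<rho>: prob_space \<rho> by fact
  have sp: "space P = space (config N)" "space \<rho> = UNIV"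
    using sets_eq_imp_space_eq[OF P(1)] sets_eq_imp_space_eq[OF \<rho>(1)] by auto
  define n where "n = 2 * N"
  define \<delta> where "\<delta> = (1 - s) / real n"
  have n: "0 < n" "real n * \<delta> = 1 - s"
    using N by (auto simp: n_def \<delta>_def)
  define M where "M i = distr P borel (\<lambda>x. x i)" for i
  have M_sets: "sets (M i) = sets borel" for i
    by (simp add: M_def)
  have M: "emeasure (M i) A = emeasure P (cyl N i A)" if "i < N" "A \<in> sets borel" for i A
  proof -
    have m: "(\<lambda>x. x i) \<in> borel_measurable P"
      using that by (subst measurable_cong_sets[OF P(1) refl]) (simp add: measurable_component_singleton)
    show ?thesis
      unfolding M_def emeasure_distr[OF m that(2)]
      by (rule arg_cong[where f="emeasure P"]) (auto simp: sp)
  qed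
  \<comment> \<open>The part of the marginal \<open>\<rho>\<close> that \<open>P\<close> still lacks
    in coordinate \<open>i\<close>.\<close>
  define d where "d i = diff_measure \<rho> (M i)" for i
  have d_sets: "sets (d i) = sets borel" for i
    by (simp add: d_def \<rho>)
  have d: "emeasure (d i) A = emeasure \<rho> A - emeasure P (cyl N i A)" if i: "i < N" and A: "A \<in> sets borel" for i A
  proof -
    have "emeasure (M i) (space (M i)) = ennreal s"
      using M[OF i, of UNIV] P(2) sp by (simp add: M_def)
    then have "finite_measure (M i)"
      by (intro finite_measureI) simp
    then show ?thesis
      unfolding d_def using i A dom M \<rho>.finite_measure_axioms
      by (subst emeasure_diff_measure) (auto simp: \<rho> M_sets)
  qed
  have d_UNIV: "emeasure (d i) UNIV = ennreal (1 - s)" if "i < N" for i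
    using d[OF that, of UNIV] P(2) sp s \<rho>.emeasure_space_1
    by (simp add: ennreal_minus flip: ennreal_1)
  have Pd: "emeasure P (cyl N i A) + emeasure (d i) A = emeasure \<rho> A" if "i < N" "A \<in> sets borel" for i A
    using that d dom by (simp add: add_diff_inverse_ennreal)
  let ?c = "\<integral>\<^sup>+x. cost \<phi> N x \<partial>P"
  let ?K = "real N ^ 3 * \<phi> r"
  have K: "0 \<le> ?K"
    using nonneg[OF r] by simp
  have "\<exists>Q. sets Q = sets (config N) \<and>
      (\<forall>i<N. \<forall>A\<in>sets borel. emeasure Q (cyl N i A) = emeasure P (cyl N i A) + ennreal (real k / real n) * emeasure (d i) A) \<and>
      (\<integral>\<^sup>+x. cost \<phi> N x \<partial>Q) \<le> ?c + ennreal (?K * (real k * \<delta>))" if "k \<le> n" and s1: "s < 1" for k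
    using \<open>k \<le> n\<close>
  proof (induction k)
    case 0
    show ?case
      using P by (intro exI[of _ P]) auto
  next
    case (Suc k)
    then obtain Q where Q: "sets Q = sets (config N)"
      and Qm: "\<And>i A. i < N \<Longrightarrow> A \<in> sets borel \<Longrightarrow> emeasure Q (cyl N i A) = emeasure P (cyl N i A) + ennreal (real k / real n) * emeasure (d i) A"
      and Qc: "(\<integral>\<^sup>+x. cost \<phi> N x \<partial>Q) \<le> ?c + ennreal (?K * (real k * \<delta>))"
      by auto
    have \<delta>: "0 < \<delta>"
      using s1 n by (simp add: \<delta>_def)
    have spQ: "space Q = space (config N)"
      using sets_eq_imp_space_eq[OF Q] .
    define t where "t = s + real k * \<delta>"
    have "emeasure Q (space Q) = ennreal s + ennreal (real k / real n) * ennreal (1 - s)"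
      using Qm[of 0 UNIV] N P(2) sp d_UNIV[of 0] by (simp add: spQ)
    also have "\<dots> = ennreal s + ennreal (real k * \<delta>)"
      using s by (simp add: ennreal_mult'[symmetric] \<delta>_def)
    also have "\<dots> = ennreal t"
      unfolding t_def using s \<delta> by (subst ennreal_plus) auto
    finally have Qt: "emeasure Q (space Q) = ennreal t" .
    have t: "1 / 2 \<le> t"
      using s \<delta> by (simp add: t_def add_increasing2)
    \<comment> \<open>Only a fraction of the missing mass has been added, so the marginals of
      \<open>Q\<close> stay below \<open>\<rho>\<close>. As \<open>t\<close> is at least 1/2, the
      constant 4 in the hypothesis on \<open>\<rho>\<close> gives the constant 2 demanded by
      \<open>augment\<close>.\<close>
    have Qclose: "emeasure Q (cyl N j (ball z r)) \<le> ennreal (t / (2 * real N ^ 4))" if j: "j < N" for j z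
    proof -
      have "ennreal (real k / real n) * emeasure (d j) (ball z r) \<le> ennreal 1 * emeasure (d j) (ball z r)"
        using Suc.prems n by (intro mult_right_mono ennreal_leI) auto
      then have "emeasure Q (cyl N j (ball z r)) \<le> emeasure P (cyl N j (ball z r)) + emeasure (d j) (ball z r)"
        using Qm[OF j, of "ball z r"] by (simp add: add_left_mono)
      also have "\<dots> = emeasure \<rho> (ball z r)"
        by (rule Pd[OF j]) simp
      also have "\<dots> \<le> ennreal (1 / (4 * real N ^ 4))"
        by (rule close)
      also have "\<dots> \<le> ennreal (t / (2 * real N ^ 4))"
        using t N by (intro ennreal_leI) (simp add: field_simps)
      finally show ?thesis .
    qed
    define \<nu> where "\<nu> i = scale_measure (ennreal (1 / real n)) (d i)" for i
    have \<nu>: "sets (\<nu> i) = sets borel" "emeasure (\<nu> i) UNIV = ennreal \<delta>" if "i < N" for i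
      using d_UNIV[OF that] n s by (simp_all add: \<nu>_def d_sets \<delta>_def ennreal_mult'[symmetric])
    \<comment> \<open>This is where the number \<open>2 * N\<close> of portions comes from:
      \<open>2 * real N * \<delta>\<close> equals \<open>1 - s\<close>, which is at most 1/2 and
      hence at most \<open>t\<close>.\<close>
    have \<delta>_le: "2 * real N * \<delta> \<le> t"
      using n(2) s t by (simp add: n_def)
    obtain Q' :: "(nat \<Rightarrow> 'a) measure" where Q': "sets Q' = sets (config N)"
      "\<And>i A. i < N \<Longrightarrow> A \<in> sets borel \<Longrightarrow> emeasure Q' (cyl N i A) = emeasure Q (cyl N i A) + emeasure (\<nu> i) A"
      "(\<integral>\<^sup>+x. cost \<phi> N x \<partial>Q') \<le> (\<integral>\<^sup>+x. cost \<phi> N x \<partial>Q) + ennreal (?K * \<delta>)"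
      by (rule augment[OF Q Qt \<delta> \<delta>_le r \<nu> Qclose]) auto
    have "emeasure Q' (cyl N i A) = emeasure P (cyl N i A) + ennreal (real (Suc k) / real n) * emeasure (d i) A"
      if iA: "i < N" "A \<in> sets borel" for i A
    proof -
      have "ennreal (real (Suc k) / real n) = ennreal (real k / real n) + ennreal (1 / real n)"
        by (subst ennreal_plus[symmetric]) (simp_all add: add_divide_distrib add.commute)
      then show ?thesis
        using Q'(2)[OF iA] Qm[OF iA] by (simp add: \<nu>_def distrib_right add.assoc)
    qed
    moreover have "(\<integral>\<^sup>+x. cost \<phi> N x \<partial>Q') \<le> ?c + ennreal (?K * (real (Suc k) * \<delta>))"
    proof -
      have "(\<integral>\<^sup>+x. cost \<phi> N x \<partial>Q') \<le> (?c + ennreal (?K * (real k * \<delta>))) + ennreal (?K * \<delta>)"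
        using Q'(3) Qc by (meson add_right_mono order_trans)
      also have "\<dots> = ?c + (ennreal (?K * (real k * \<delta>)) + ennreal (?K * \<delta>))"
        by (simp only: add.assoc)
      also have "ennreal (?K * (real k * \<delta>)) + ennreal (?K * \<delta>) = ennreal (?K * (real (Suc k) * \<delta>))"
        using K \<delta> by (subst ennreal_plus[symmetric]) (auto simp: algebra_simps)
      finally show ?thesis .
    qed
    ultimately show ?case
      using Q'(1) by blast
  qed
  note step = this
  obtain Q where Q: "sets Q = sets (config N)"
    and Qm: "\<And>i A. i < N \<Longrightarrow> A \<in> sets borel \<Longrightarrow> emeasure Q (cyl N i A) = emeasure \<rho> A"
    and Qc: "(\<integral>\<^sup>+x. cost \<phi> N x \<partial>Q) \<le> ?c + ennreal (?K * (1 - s))"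
  \<comment> \<open>For \<open>s = 1\<close> the portions would have mass 0, which
    \<open>augment\<close> excludes; in that case \<open>P\<close> already has the right
    marginals.\<close>
  proof (cases "s < 1")
    case True
    show thesis
      using step[OF order_refl True] n Pd that by auto
  next
    case False
    have "emeasure (d i) A = 0" if "i < N" "A \<in> sets borel" for i A
      using emeasure_mono[of A UNIV "d i"] d_UNIV[OF that(1)] d_sets[of i] False s by auto
    then show thesis
      using that[of P] P Pd False s by auto
  qed
  have "transport_cost \<phi> N \<rho> \<le> (\<integral>\<^sup>+x. cost \<phi> N x \<partial>Q)"
    unfolding transport_cost_def by (rule INF_lower) (rule transport_plansI[OF Q \<rho> Qm])
  with Qc show ?thesis
    by (rule order_trans[rotated])
qed

text \<open>Under the product measure the at most \<open>N ^ 2\<close> pairs are each closer than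
  \<open>r\<close> with probability at most \<open>1 / (4 * real N ^ 4)\<close>, so the separated
  configurations have mass at least 1/2. There the cost is at most
  \<open>real N ^ 2 * \<phi> r\<close>; the other summand pays for completion.\<close>

lemma transport_cost_bounded:
  fixes \<rho> :: "'a::euclidean_space measure"
  assumes r: "0 < r" and \<rho>: "sets \<rho> = sets borel" "prob_space \<rho>"
    and close: "\<And>z. emeasure \<rho> (ball z r) \<le> ennreal (1 / (4 * real N ^ 4))"
  shows "transport_cost \<phi> N \<rho> \<le> ennreal (real N ^ 2 * \<phi> r + real N ^ 3 * \<phi> r)"
proof -
  interpret \<rho>: prob_space \<rho> by fact
  let ?E = "config N :: (nat \<Rightarrow> 'a) measure"
  define X where "X = PiM {..<N} (\<lambda>_. \<rho>)"
  interpret PP: product_prob_space "\<lambda>_. \<rho>" "{..<N}" ..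
  interpret X: prob_space X
    unfolding X_def by (intro prob_space_PiM \<rho>)
  have X_sets: "sets X = sets ?E"
    unfolding X_def by (rule sets_PiM_cong) (auto simp: \<rho>)
  then have spX: "space X = space ?E"
    by (rule sets_eq_imp_space_eq)
  have xi: "(\<lambda>x. x i) \<in> borel_measurable X" if "i < N" for i
    using that by (subst measurable_cong_sets[OF X_sets refl]) (simp add: measurable_component_singleton)
  define J where "J = {(i, j). i < N \<and> j < N \<and> i \<noteq> j}"
  define B where "B = (\<lambda>(i, j). {x \<in> space X. dist (x i) (x j) < r})"
  have Jsub: "J \<subseteq> {..<N} \<times> {..<N}"
    by (auto simp: J_def)
  then have Jfin: "finite J"
    by (rule finite_subset) simp
  have Jcard: "card J \<le> N * N"
    using card_mono[OF _ Jsub] by simp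
  have Bm: "B p \<in> sets X" if "p \<in> J" for p
  proof -
    obtain i j where p: "p = (i, j)" "i < N" "j < N"
      using \<open>p \<in> J\<close> by (auto simp: J_def)
    have "(\<lambda>x. dist (x i) (x j)) \<in> borel_measurable X"
      using p by (intro borel_measurable_dist xi)
    then show ?thesis
      unfolding p B_def by simp
  qed
  have Bp: "emeasure X (B p) \<le> ennreal (1 / (4 * real N ^ 4))" if "p \<in> J" for p
  proof -
    obtain i j where p: "p = (i, j)" "i < N" "j < N" "i \<noteq> j"
      using \<open>p \<in> J\<close> by (auto simp: J_def)
    have id: "(\<lambda>x. x) \<in> borel_measurable \<rho>"
      by (subst measurable_cong_sets[OF \<rho>(1) refl]) simp
    have "{y \<in> space \<rho>. dist y z < r} = ball z r" for z
      using sets_eq_imp_space_eq[OF \<rho>(1)] by (auto simp: dist_commute)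
    then have "emeasure X {x \<in> space X. dist (x i) (x j) < r} \<le> ennreal (1 / (4 * real N ^ 4))"
      unfolding X_def using close p
      by (intro emeasure_PiM_close[where f="\<lambda>x. x" and g="\<lambda>x. x"] \<rho> id) auto
    then show ?thesis
      by (simp add: p B_def)
  qed
  define G where "G = space X - (\<Union>p\<in>J. B p)"
  have UB: "(\<Union>p\<in>J. B p) \<in> sets X"
    using Jfin Bm by (rule sets.finite_UN)
  have G: "G \<in> sets X"
    unfolding G_def using UB by blast
  have "emeasure X (\<Union>p\<in>J. B p) \<le> (\<Sum>p\<in>J. emeasure X (B p))"
    using Bm Jfin by (intro emeasure_subadditive_finite) auto
  also have "\<dots> \<le> (\<Sum>p\<in>J. ennreal (1 / (4 * real N ^ 4)))"
    by (intro sum_mono Bp)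
  also have "\<dots> = ennreal (real (card J) * (1 / (4 * real N ^ 4)))"
    unfolding sum_constant ennreal_of_nat_eq_real_of_nat by (rule ennreal_mult'[symmetric]) simp
  also have "\<dots> \<le> ennreal (1 / 2)"
  proof (rule ennreal_leI)
    have "real (card J) \<le> real N ^ 2"
      using Jcard by (metis of_nat_le_iff of_nat_mult power2_eq_square)
    also have "\<dots> \<le> real N ^ 4"
      using N by (intro power_increasing) auto
    finally have "real (card J) \<le> real N ^ 4" .
    moreover have "0 \<le> real N ^ 4"
      by simp
    ultimately have "real (card J) \<le> 2 * real N ^ 4"
      by linarith
    then show "real (card J) * (1 / (4 * real N ^ 4)) \<le> 1 / 2"
      using N by (simp add: field_simps)
  qed
  finally have UB_le: "emeasure X (\<Union>p\<in>J. B p) \<le> ennreal (1 / 2)" .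
  define s where "s = measure X G"
  have "measure X (\<Union>p\<in>J. B p) \<le> 1 / 2"
    using UB_le by (simp add: X.emeasure_eq_measure ennreal_le_iff del: ennreal_half)
  then have s: "1 / 2 \<le> s" "s \<le> 1"
    unfolding s_def G_def using UB X.prob_compl[OF UB] by (auto simp: X.prob_le_1)
  \<comment> \<open>Restricting the product to \<open>G\<close> can only decrease its marginals,
    which gives the domination required by \<open>complete_plan\<close>.\<close>
  define P where "P = density X (indicator G)"
  have P_em: "emeasure P A = emeasure X (G \<inter> A)" if "A \<in> sets ?E" for A
    unfolding P_def using that G X_sets by (subst emeasure_density) (auto simp: nn_integral_indicator[symmetric] indicator_inter_arith simp del: nn_integral_indicator)
  have P_sets: "sets P = sets ?E"
    by (simp add: P_def X_sets)
  have P_s: "emeasure P (space P) = ennreal s"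
    using P_em[of "space ?E"] sets.sets_into_space[OF G] by (simp add: P_def spX s_def X.emeasure_eq_measure Int_absorb2)
  have dom: "emeasure P (cyl N i A) \<le> emeasure \<rho> A" if iA: "i < N" "A \<in> sets borel" for i A
  proof -
    have "emeasure P (cyl N i A) \<le> emeasure X (cyl N i A)"
      unfolding P_em[OF cyl_sets[OF iA]] using cyl_sets[OF iA] X_sets by (intro emeasure_mono) auto
    also have "\<dots> = emeasure X {x \<in> space X. x i \<in> A}"
      by (simp add: spX)
    also have "\<dots> = emeasure \<rho> A"
      unfolding X_def using iA \<rho> by (intro PP.emeasure_PiM_Collect_single) auto
    finally show ?thesis .
  qed
  have "(\<integral>\<^sup>+x. cost \<phi> N x \<partial>P) = (\<integral>\<^sup>+x. indicator G x * cost \<phi> N x \<partial>X)"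
    unfolding P_def using G cost_measurable measurable_cong_sets[OF X_sets refl]
    by (subst nn_integral_density) auto
  also have "\<dots> \<le> (\<integral>\<^sup>+x. ennreal (real N ^ 2 * \<phi> r) \<partial>X)"
  proof (rule nn_integral_mono)
    fix x assume "x \<in> space X"
    show "indicator G x * cost \<phi> N x \<le> ennreal (real N ^ 2 * \<phi> r)"
    proof (cases "x \<in> G")
      case True
      then have "r \<le> dist (x i) (x j)" if "i < N" "j < N" "i \<noteq> j" for i j
        using that by (force simp: G_def J_def B_def)
      then show ?thesis
        using True cost_le[OF r, of x] by simp
    qed simp
  qed
  also have "\<dots> = ennreal (real N ^ 2 * \<phi> r)"
    by (simp add: X.emeasure_space_1)
  finally have c: "(\<integral>\<^sup>+x. cost \<phi> N x \<partial>P) \<le> ennreal (real N ^ 2 * \<phi> r)" .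
  have "transport_cost \<phi> N \<rho> \<le> (\<integral>\<^sup>+x. cost \<phi> N x \<partial>P) + ennreal (real N ^ 3 * \<phi> r * (1 - s))"
    by (rule complete_plan[OF P_sets P_s s r \<rho> dom close])
  also have "\<dots> \<le> ennreal (real N ^ 2 * \<phi> r) + ennreal (real N ^ 3 * \<phi> r * 1)"
    using s nonneg[OF r] by (intro add_mono c ennreal_leI mult_left_mono) auto
  also have "\<dots> = ennreal (real N ^ 2 * \<phi> r + real N ^ 3 * \<phi> r)"
    using nonneg[OF r] by (subst ennreal_plus) auto
  finally show ?thesis .
qed

end

section \<open>Comparing the costs of two densities\<close>

lemma Lp_norm_1: "Lp_norm 1 f = (LINT x|lborel. norm (f x))"
  by (simp add: Lp_norm_def)

lemma prob_densityD:
  fixes \<rho> :: "'a::euclidean_space \<Rightarrow> real"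
  assumes "prob_density \<rho>"
  shows "\<rho> \<in> borel_measurable borel" "integrable lborel \<rho>" "AE x in lborel. 0 \<le> \<rho> x"
    "prob_space (density_measure \<rho>)"
proof -
  show meas: "\<rho> \<in> borel_measurable borel" and nn: "AE x in lborel. 0 \<le> \<rho> x"
    using assms by (auto simp: prob_density_def in_Lp_def)
  have "integrable lborel (\<lambda>x. norm (\<rho> x))"
    using assms by (simp add: prob_density_def in_Lp_def)
  then show int: "integrable lborel \<rho>"
    using meas by (subst (asm) integrable_norm_iff) auto
  have "(\<integral>\<^sup>+x. ennreal (\<rho> x) \<partial>lborel) = ennreal (LINT x|lborel. \<rho> x)"
    using int nn by (rule nn_integral_eq_integral)
  then have "(\<integral>\<^sup>+x. ennreal (\<rho> x) \<partial>lborel) = 1"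
    using assms by (simp add: prob_density_def)
  then show "prob_space (density_measure \<rho>)"
    using meas by (intro prob_spaceI) (simp add: emeasure_density)
qed

context repulsive_cost
begin

text \<open>With weight \<open>F\<close>, the product of the \<open>f (x i)\<close>, three bounds
  suffice. \<open>F \<le> f (x i)\<close> and \<open>\<rho>\<^sub>1 f \<le> \<rho>\<^sub>2\<close>
  dominate each marginal; \<open>F \<le> 1\<close> does not raise the cost; and the lost mass is at
  most the sum over \<open>i\<close> of the integrals of \<open>\<rho>\<^sub>1 (1 - f)\<close>, each
  at most the distance of the densities.\<close>

lemma thin_plan:
  fixes \<rho>\<^sub>1 \<rho>\<^sub>2 :: "'a::euclidean_space \<Rightarrow> real"
  assumes \<rho>1: "prob_density \<rho>\<^sub>1" and \<rho>2: "prob_density \<rho>\<^sub>2"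
    and P: "P \<in> transport_plans N (density_measure \<rho>\<^sub>1)"
  obtains Q s where "sets Q = sets (config N)" "emeasure Q (space Q) = ennreal s"
    "1 - real N * Lp_norm 1 (\<lambda>x. \<rho>\<^sub>1 x - \<rho>\<^sub>2 x) \<le> s" "s \<le> 1"
    "\<And>i A. i < N \<Longrightarrow> A \<in> sets borel \<Longrightarrow> emeasure Q (cyl N i A) \<le> emeasure (density_measure \<rho>\<^sub>2) A"
    "(\<integral>\<^sup>+x. cost \<phi> N x \<partial>Q) \<le> (\<integral>\<^sup>+x. cost \<phi> N x \<partial>P)"
proof -
  note m1[measurable] = prob_densityD(1)[OF \<rho>1] and m2[measurable] = prob_densityD(1)[OF \<rho>2]
  from P have P_sets: "sets P = sets (config N)" and "prob_space P"
    and P_marg: "\<And>i. i < N \<Longrightarrow> distr P borel (\<lambda>x. x i) = density_measure \<rho>\<^sub>1"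
    by (auto simp: transport_plans_def)
  interpret P: prob_space P by fact
  have spP: "space P = space (config N)"
    using P_sets by (rule sets_eq_imp_space_eq)
  have xi[measurable]: "(\<lambda>x. x i) \<in> borel_measurable P" if "i < N" for i
    using that by (subst measurable_cong_sets[OF P_sets refl]) (simp add: measurable_component_singleton)
  \<comment> \<open>The densities are nonnegative only almost everywhere, so the ratio is clamped to
    keep \<open>f\<close> in the unit interval at every point. Where \<open>\<rho>\<^sub>1\<close>
    is not positive its measure has no mass, and the value 1 is harmless.\<close>
  define f where "f x = (if \<rho>\<^sub>1 x \<le> 0 then 1 else max 0 (min 1 (\<rho>\<^sub>2 x / \<rho>\<^sub>1 x)))" for x
  have f_meas[measurable]: "f \<in> borel_measurable borel"
    unfolding f_def[abs_def] by measurable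
  have f01: "0 \<le> f x" "f x \<le> 1" for x
    by (auto simp: f_def)
  have f_le: "ennreal (\<rho>\<^sub>1 x) * ennreal (f x) \<le> ennreal (\<rho>\<^sub>2 x)" for x
  proof (cases "\<rho>\<^sub>1 x \<le> 0")
    case True
    then show ?thesis
      by (simp add: ennreal_neg)
  next
    case False
    then have "\<rho>\<^sub>1 x * f x \<le> max 0 (\<rho>\<^sub>2 x)"
      by (auto simp: f_def max_def min_def field_simps)
    then have "ennreal (\<rho>\<^sub>1 x * f x) \<le> ennreal (max 0 (\<rho>\<^sub>2 x))"
      by (rule ennreal_leI)
    then show ?thesis
      using f01 by (simp add: ennreal_mult'' max_def ennreal_neg split: if_splits)
  qed
  have f_diff: "ennreal (\<rho>\<^sub>1 x) * ennreal (1 - f x) \<le> ennreal (norm (\<rho>\<^sub>1 x - \<rho>\<^sub>2 x))" if "0 \<le> \<rho>\<^sub>2 x" for x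
  proof (cases "\<rho>\<^sub>1 x \<le> 0")
    case True
    then show ?thesis
      by (simp add: ennreal_neg)
  next
    case False
    then have "\<rho>\<^sub>1 x * (1 - f x) \<le> norm (\<rho>\<^sub>1 x - \<rho>\<^sub>2 x)"
      using that by (auto simp: f_def max_def min_def field_simps)
    then have "ennreal (\<rho>\<^sub>1 x * (1 - f x)) \<le> ennreal (norm (\<rho>\<^sub>1 x - \<rho>\<^sub>2 x))"
      by (rule ennreal_leI)
    then show ?thesis
      using f01 by (simp add: ennreal_mult'')
  qed
  have marg_int: "(\<integral>\<^sup>+x. g (x i) \<partial>P) = (\<integral>\<^sup>+x. ennreal (\<rho>\<^sub>1 x) * g x \<partial>lborel)"
    if i: "i < N" and [measurable]: "g \<in> borel_measurable borel" for i g
  proof -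
    have "(\<integral>\<^sup>+x. g (x i) \<partial>P) = (\<integral>\<^sup>+x. g x \<partial>distr P borel (\<lambda>x. x i))"
      using nn_integral_distr[OF xi[OF i], of g] by simp
    also have "\<dots> = (\<integral>\<^sup>+x. g x \<partial>density_measure \<rho>\<^sub>1)"
      by (simp add: P_marg i)
    also have "\<dots> = (\<integral>\<^sup>+x. ennreal (\<rho>\<^sub>1 x) * g x \<partial>lborel)"
      by (rule nn_integral_density[of _ lborel]) simp_all
    finally show ?thesis .
  qed
  define F where "F x = (\<Prod>i<N. f (x i))" for x
  have F01: "0 \<le> F x" "F x \<le> 1" for x
    unfolding F_def using f01 by (auto intro!: prod_nonneg prod_le_1)
  have F_le: "F x \<le> f (x i)" if "i < N" for x i
  proof -
    have "F x = f (x i) * (\<Prod>j\<in>{..<N} - {i}. f (x j))"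
      unfolding F_def using that by (subst prod.remove[of _ i]) auto
    also have "\<dots> \<le> f (x i) * 1"
      using f01 by (intro mult_left_mono prod_le_1) auto
    finally show ?thesis
      by simp
  qed
  have F_meas[measurable]: "F \<in> borel_measurable P"
    unfolding F_def[abs_def]
    by (intro borel_measurable_prod measurable_compose[OF xi f_meas]) auto
  define Q where "Q = density P (\<lambda>x. ennreal (F x))"
  have Q_sets: "sets Q = sets (config N)"
    by (simp add: Q_def P_sets)
  have spQ: "space Q = space P"
    by (simp add: Q_def)
  have Q_F: "emeasure Q (space Q) = (\<integral>\<^sup>+x. ennreal (F x) \<partial>P)"
    unfolding Q_def by (subst emeasure_density) (auto intro!: nn_integral_cong)
  also have "\<dots> \<le> (\<integral>\<^sup>+x. 1 \<partial>P)"
    using F01 by (intro nn_integral_mono) simp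
  finally have "emeasure Q (space Q) \<le> (\<integral>\<^sup>+x. 1 \<partial>P)" .
  then have Q1: "emeasure Q (space Q) \<le> 1"
    by (simp add: P.emeasure_space_1)
  define s where "s = enn2real (emeasure Q (space Q))"
  have s: "emeasure Q (space Q) = ennreal s" "0 \<le> s"
    using le_less_trans[OF Q1, of \<top>] by (simp_all add: s_def)
  have s1: "s \<le> 1"
    using Q1 unfolding s(1) by simp
  let ?D = "Lp_norm 1 (\<lambda>x. \<rho>\<^sub>1 x - \<rho>\<^sub>2 x)"
  have D: "(\<integral>\<^sup>+x. ennreal (norm (\<rho>\<^sub>1 x - \<rho>\<^sub>2 x)) \<partial>lborel) = ennreal ?D"
    unfolding Lp_norm_1 using prob_densityD(2)[OF \<rho>1] prob_densityD(2)[OF \<rho>2]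
    by (intro nn_integral_eq_integral integrable_norm) auto
  \<comment> \<open>Weierstrass' inequality for products: one minus the product of numbers in the
    unit interval is at most the sum of their defects.\<close>
  have one: "(1::ennreal) \<le> ennreal (F x) + (\<Sum>i<N. ennreal (1 - f (x i)))" for x
  proof -
    have "1 - (\<Sum>i<N. 1 - f (x i)) \<le> (\<Prod>i<N. 1 - (1 - f (x i)))"
      using f01 by (intro Weierstrass_prod_ineq) auto
    then have "1 \<le> F x + (\<Sum>i<N. 1 - f (x i))"
      by (simp add: F_def)
    then have "ennreal 1 \<le> ennreal (F x + (\<Sum>i<N. 1 - f (x i)))"
      by (rule ennreal_leI)
    also have "\<dots> = ennreal (F x) + (\<Sum>i<N. ennreal (1 - f (x i)))"
      using F01 f01 by (simp add: ennreal_plus sum_nonneg sum_ennreal)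
    finally show ?thesis
      by simp
  qed
  have "ennreal 1 = (\<integral>\<^sup>+x. 1 \<partial>P)"
    by (simp add: P.emeasure_space_1)
  also have "\<dots> \<le> (\<integral>\<^sup>+x. ennreal (F x) + (\<Sum>i<N. ennreal (1 - f (x i))) \<partial>P)"
    by (intro nn_integral_mono one)
  also have "\<dots> = (\<integral>\<^sup>+x. ennreal (F x) \<partial>P) + (\<Sum>i<N. \<integral>\<^sup>+x. ennreal (1 - f (x i)) \<partial>P)"
  proof -
    have [measurable]: "(\<lambda>x. ennreal (1 - f (x i))) \<in> borel_measurable P" if "i \<in> {..<N}" for i
      using that by (intro measurable_compose[OF xi, of _ "\<lambda>y. ennreal (1 - f y)"]) auto
    show ?thesis
      by (subst nn_integral_add) (auto simp: nn_integral_sum)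
  qed
  also have "\<dots> \<le> ennreal s + (\<Sum>i<N. ennreal ?D)"
  proof (intro add_mono sum_mono)
    show "(\<integral>\<^sup>+x. ennreal (F x) \<partial>P) \<le> ennreal s"
      using s Q_F by simp
    fix i assume i: "i \<in> {..<N}"
    have "(\<integral>\<^sup>+x. ennreal (1 - f (x i)) \<partial>P) = (\<integral>\<^sup>+x. ennreal (\<rho>\<^sub>1 x) * ennreal (1 - f x) \<partial>lborel)"
      using i by (intro marg_int) auto
    also have "\<dots> \<le> (\<integral>\<^sup>+x. ennreal (norm (\<rho>\<^sub>1 x - \<rho>\<^sub>2 x)) \<partial>lborel)"
      using prob_densityD(3)[OF \<rho>2] by (intro nn_integral_mono_AE) (auto elim!: eventually_mono intro: f_diff[unfolded real_norm_def])
    finally show "(\<integral>\<^sup>+x. ennreal (1 - f (x i)) \<partial>P) \<le> ennreal ?D"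
      unfolding D .
  qed
  also have "\<dots> = ennreal s + ennreal (real N * ?D)"
    unfolding sum_constant ennreal_of_nat_eq_real_of_nat card_lessThan by (simp add: ennreal_mult')
  also have "\<dots> = ennreal (s + real N * ?D)"
    using s by (subst ennreal_plus) (auto simp: Lp_norm_1)
  finally have mass: "1 - real N * ?D \<le> s"
    using s by (subst (asm) ennreal_le_iff) (auto simp: Lp_norm_1)
  show thesis
  proof (rule that[OF Q_sets s(1) mass s1])
    fix i and A :: "'a set" assume i: "i < N" and A[measurable]: "A \<in> sets borel"
    have cyl: "cyl N i A \<in> sets P"
      unfolding P_sets using i A by (rule cyl_sets)
    have "emeasure Q (cyl N i A) = (\<integral>\<^sup>+x. ennreal (F x) * indicator (cyl N i A) x \<partial>P)"
      unfolding Q_def using cyl by (subst emeasure_density) auto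
    also have "\<dots> \<le> (\<integral>\<^sup>+x. ennreal (f (x i)) * indicator A (x i) \<partial>P)"
      by (intro nn_integral_mono mult_mono ennreal_leI F_le i) (auto simp: indicator_def)
    also have "\<dots> = (\<integral>\<^sup>+x. ennreal (\<rho>\<^sub>1 x) * (ennreal (f x) * indicator A x) \<partial>lborel)"
      using i by (intro marg_int[of i "\<lambda>x. ennreal (f x) * indicator A x"]) auto
    also have "\<dots> \<le> (\<integral>\<^sup>+x. ennreal (\<rho>\<^sub>2 x) * indicator A x \<partial>lborel)"
      using f_le by (intro nn_integral_mono) (auto simp: indicator_def)
    also have "\<dots> = emeasure (density_measure \<rho>\<^sub>2) A"
      by (subst emeasure_density) auto
    finally show "emeasure Q (cyl N i A) \<le> emeasure (density_measure \<rho>\<^sub>2) A" .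
  next
    have cm: "cost \<phi> N \<in> borel_measurable P"
      using cost_measurable by (subst measurable_cong_sets[OF P_sets refl])
    have "(\<integral>\<^sup>+x. cost \<phi> N x \<partial>Q) = (\<integral>\<^sup>+x. ennreal (F x) * cost \<phi> N x \<partial>P)"
      unfolding Q_def by (rule nn_integral_density) (use cm in auto)
    also have "\<dots> \<le> (\<integral>\<^sup>+x. 1 * cost \<phi> N x \<partial>P)"
      using F01 by (intro nn_integral_mono mult_right_mono) auto
    finally show "(\<integral>\<^sup>+x. cost \<phi> N x \<partial>Q) \<le> (\<integral>\<^sup>+x. cost \<phi> N x \<partial>P)"
      by simp
  qed
qed

text \<open>Thin an arbitrary plan of \<open>\<rho>\<^sub>1\<close> and complete it to a plan of
  \<open>\<rho>\<^sub>2\<close>. The smallness hypothesis keeps the thinned mass above 1/2, and the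
  mass loss contributes the extra factor \<open>N\<close> that turns \<open>real N ^ 3\<close> into
  \<open>real N ^ 4\<close>.\<close>

lemma transport_cost_one_sided:
  fixes \<rho>\<^sub>1 \<rho>\<^sub>2 :: "'a::euclidean_space \<Rightarrow> real"
  assumes \<rho>1: "prob_density \<rho>\<^sub>1" and \<rho>2: "prob_density \<rho>\<^sub>2" and r: "0 < r"
    and close: "\<And>z. emeasure (density_measure \<rho>\<^sub>2) (ball z r) \<le> ennreal (1 / (4 * real N ^ 4))"
    and small: "real N * Lp_norm 1 (\<lambda>x. \<rho>\<^sub>1 x - \<rho>\<^sub>2 x) \<le> 1 / 2"
  shows "transport_cost \<phi> N (density_measure \<rho>\<^sub>2) \<le> transport_cost \<phi> N (density_measure \<rho>\<^sub>1)
    + ennreal (real N ^ 4 * \<phi> r * Lp_norm 1 (\<lambda>x. \<rho>\<^sub>1 x - \<rho>\<^sub>2 x))"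
proof -
  let ?D = "Lp_norm 1 (\<lambda>x. \<rho>\<^sub>1 x - \<rho>\<^sub>2 x)"
  let ?C = "ennreal (real N ^ 4 * \<phi> r * ?D)"
  \<comment> \<open>The finite constant is moved to the left so that the infimum over
    \<open>P\<close> can be taken on the right without choosing an optimal plan.\<close>
  have "transport_cost \<phi> N (density_measure \<rho>\<^sub>2) - ?C \<le> (\<integral>\<^sup>+x. cost \<phi> N x \<partial>P)"
    if P: "P \<in> transport_plans N (density_measure \<rho>\<^sub>1)" for P
  proof -
    obtain Q s where Q: "sets Q = sets (config N :: (nat \<Rightarrow> 'a) measure)" "emeasure Q (space Q) = ennreal s"
      and s: "1 - real N * ?D \<le> s" "s \<le> 1"
      and dom: "\<And>i A. i < N \<Longrightarrow> A \<in> sets borel \<Longrightarrow> emeasure Q (cyl N i A) \<le> emeasure (density_measure \<rho>\<^sub>2) A"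
      and Qc: "(\<integral>\<^sup>+x. cost \<phi> N x \<partial>Q) \<le> (\<integral>\<^sup>+x. cost \<phi> N x \<partial>P)"
      by (rule thin_plan[OF \<rho>1 \<rho>2 P]) blast
    have "1 / 2 \<le> s"
      using s small by linarith
    have "transport_cost \<phi> N (density_measure \<rho>\<^sub>2) \<le> (\<integral>\<^sup>+x. cost \<phi> N x \<partial>Q) + ennreal (real N ^ 3 * \<phi> r * (1 - s))"
      by (rule complete_plan[OF Q \<open>1 / 2 \<le> s\<close> s(2) r _ _ dom close]) (simp_all add: prob_densityD(4)[OF \<rho>2])
    also have "\<dots> \<le> (\<integral>\<^sup>+x. cost \<phi> N x \<partial>P) + ennreal (real N ^ 3 * \<phi> r * (real N * ?D))"
      using s nonneg[OF r] by (intro add_mono Qc ennreal_leI mult_left_mono) auto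
    also have "real N ^ 3 * \<phi> r * (real N * ?D) = real N ^ 4 * \<phi> r * ?D"
      by (simp add: power3_eq_cube power4_eq_xxxx)
    finally show ?thesis
      by (simp add: ennreal_minus_le_iff add.commute)
  qed
  then have "transport_cost \<phi> N (density_measure \<rho>\<^sub>2) - ?C \<le> transport_cost \<phi> N (density_measure \<rho>\<^sub>1)"
    unfolding transport_cost_def[of \<phi> N "density_measure \<rho>\<^sub>1"] by (rule INF_greatest)
  then show ?thesis
    by (simp add: ennreal_minus_le_iff add.commute)
qed

text \<open>For close densities the one-sided estimate is used in both directions. When
  \<open>real N\<close> times the distance exceeds 1/2, the uniform bound \<open>B\<close> on the
  cost already suffices, since \<open>B\<close> is at most \<open>2 * real N * B\<close> times the
  distance. \<open>L\<close> adds the two constants.\<close>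

lemma cost_lipschitz_if_equiconcentrated:
  fixes S :: "('a::euclidean_space \<Rightarrow> real) set"
  assumes S: "\<And>\<rho>. \<rho> \<in> S \<Longrightarrow> prob_density \<rho>" and r: "0 < r"
    and close: "\<And>\<rho> z. \<rho> \<in> S \<Longrightarrow> emeasure (density_measure \<rho>) (ball z r) \<le> ennreal (1 / (4 * real N ^ 4))"
  shows "\<exists>L. cost_L1_lipschitz_on L \<phi> N S"
proof -
  define B where "B = real N ^ 2 * \<phi> r + real N ^ 3 * \<phi> r"
  define L where "L = real N ^ 4 * \<phi> r + 2 * real N * B"
  let ?C = "\<lambda>\<rho>. transport_cost \<phi> N (density_measure \<rho>)"
  have B0: "0 \<le> B"
    using nonneg[OF r] by (simp add: B_def)
  have CB: "?C \<rho> \<le> ennreal B" if "\<rho> \<in> S" for \<rho>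
    unfolding B_def using that
    by (intro transport_cost_bounded r prob_densityD(4) S close) auto
  have C_fin: "?C \<rho> < \<infinity>" if "\<rho> \<in> S" for \<rho>
    using CB[OF that] by (auto simp: less_top[symmetric] top_unique)
  have one: "enn2real (?C \<rho>\<^sub>2) - enn2real (?C \<rho>\<^sub>1) \<le> L * Lp_norm 1 (\<lambda>x. \<rho>\<^sub>1 x - \<rho>\<^sub>2 x)"
    if in_S: "\<rho>\<^sub>1 \<in> S" "\<rho>\<^sub>2 \<in> S" for \<rho>\<^sub>1 \<rho>\<^sub>2
  proof -
    let ?D = "Lp_norm 1 (\<lambda>x. \<rho>\<^sub>1 x - \<rho>\<^sub>2 x)"
    have D0: "0 \<le> ?D"
      by (simp add: Lp_norm_1)
    show ?thesis
    proof (cases "real N * ?D \<le> 1 / 2")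
      case True
      have "?C \<rho>\<^sub>2 \<le> ?C \<rho>\<^sub>1 + ennreal (real N ^ 4 * \<phi> r * ?D)"
        using True in_S by (intro transport_cost_one_sided S r close) auto
      then have "enn2real (?C \<rho>\<^sub>2) \<le> enn2real (?C \<rho>\<^sub>1 + ennreal (real N ^ 4 * \<phi> r * ?D))"
        using C_fin[OF in_S(1)] by (intro enn2real_mono) auto
      also have "\<dots> = enn2real (?C \<rho>\<^sub>1) + real N ^ 4 * \<phi> r * ?D"
        using C_fin[OF in_S(1)] nonneg[OF r] D0 by (subst enn2real_plus) auto
      also have "\<dots> \<le> enn2real (?C \<rho>\<^sub>1) + L * ?D"
        using B0 D0 by (intro add_left_mono mult_right_mono) (auto simp: L_def)
      finally show ?thesis
        by simp
    next
      case False
      have "enn2real (?C \<rho>\<^sub>2) \<le> B"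
        using CB[OF in_S(2)] B0 by (simp add: enn2real_leI)
      then have "enn2real (?C \<rho>\<^sub>2) - enn2real (?C \<rho>\<^sub>1) \<le> B * 1"
        using enn2real_nonneg[of "?C \<rho>\<^sub>1"] by linarith
      also have "\<dots> \<le> B * (2 * (real N * ?D))"
        using False B0 by (intro mult_left_mono) auto
      also have "\<dots> = (2 * real N * B) * ?D"
        by simp
      also have "\<dots> \<le> L * ?D"
        using nonneg[OF r] D0 by (intro mult_right_mono) (auto simp: L_def)
      finally show ?thesis .
    qed
  qed
  have "cost_L1_lipschitz_on L \<phi> N S"
    unfolding cost_L1_lipschitz_on_def
  proof (intro conjI ballI C_fin)
    fix \<rho>\<^sub>1 \<rho>\<^sub>2 assume in_S: "\<rho>\<^sub>1 \<in> S" "\<rho>\<^sub>2 \<in> S"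
    have "Lp_norm 1 (\<lambda>x. \<rho>\<^sub>2 x - \<rho>\<^sub>1 x) = Lp_norm 1 (\<lambda>x. \<rho>\<^sub>1 x - \<rho>\<^sub>2 x)"
      by (simp add: Lp_norm_def norm_minus_commute abs_minus_commute)
    then show "\<bar>enn2real (?C \<rho>\<^sub>1) - enn2real (?C \<rho>\<^sub>2)\<bar> \<le> L * Lp_norm 1 (\<lambda>x. \<rho>\<^sub>1 x - \<rho>\<^sub>2 x)"
      using one[OF in_S] one[OF in_S(2,1)] by (simp add: abs_le_iff)
  qed
  then show ?thesis ..
qed

end

section \<open>Concentration in \<open>L\<^sup>p\<close>\<close>

text \<open>For a radius of at most 1 and dimension at least 1, the volume is at most a constant
  times the radius itself, so no root has to be extracted.\<close>

lemma small_balls: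
  assumes "0 < \<epsilon>"
  obtains r where "0 < r" "\<And>z::'a::euclidean_space. emeasure lborel (ball z r) \<le> ennreal \<epsilon>"
proof -
  let ?v = "unit_ball_vol (real DIM('a))"
  have v: "0 < ?v"
    by simp
  define r where "r = min 1 (\<epsilon> / ?v)"
  have r: "0 < r" "r \<le> 1"
    using assms v by (auto simp: r_def)
  have "emeasure lborel (ball z r) \<le> ennreal \<epsilon>" for z :: 'a
  proof -
    have "r ^ DIM('a) \<le> r ^ 1"
      using r by (intro power_decreasing) (auto simp: Suc_le_eq)
    then have "?v * r ^ DIM('a) \<le> ?v * (\<epsilon> / ?v)"
      using v by (intro mult_left_mono) (auto simp: r_def)
    also have "\<dots> = \<epsilon>"
      using v by (intro nonzero_mult_div_cancel_left[where 'a=real, folded times_divide_eq_right]) linarith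
    finally have "?v * r ^ DIM('a) \<le> \<epsilon>" .
    then show ?thesis
      using r by (simp add: emeasure_ball ennreal_leI)
  qed
  with r(1) show thesis
    by (rule that)
qed

text \<open>Integrating the pointwise bound splits the mass of a ball into \<open>T\<close> times
  its volume and a tail of size \<open>B * T powr (1 - p)\<close>. First \<open>T\<close> is taken
  so large that the tail is below \<open>\<kappa> / 2\<close>, then \<open>r\<close> so small that
  the other term is.\<close>

lemma Lp_equiconcentrated:
  assumes p: "1 < p" and \<kappa>: "0 < \<kappa>"
  obtains r where "0 < r"
    "\<And>(\<rho> :: 'a::euclidean_space \<Rightarrow> real) z. in_Lp p \<rho> \<Longrightarrow> Lp_norm p \<rho> \<le> M \<Longrightarrow>
       emeasure (density_measure \<rho>) (ball z r) \<le> ennreal \<kappa>"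
proof -
  \<comment> \<open>The maximum covers a negative \<open>M\<close>, as \<open>powr\<close> is
    monotone in the base only for nonnegative bases.\<close>
  define B where "B = max 0 M powr p"
  have B: "0 \<le> B"
    by (simp add: B_def)
  have "((\<lambda>T. T powr (1 - p)) \<longlongrightarrow> 0) at_top"
    using p by (intro tendsto_neg_powr filterlim_ident) auto
  then have "((\<lambda>T. B * T powr (1 - p)) \<longlongrightarrow> B * 0) at_top"
    by (intro tendsto_intros)
  then have "eventually (\<lambda>T. B * T powr (1 - p) < \<kappa> / 2) at_top"
    using \<kappa> by (intro order_tendstoD) auto
  then obtain T where T: "0 < T" "B * T powr (1 - p) < \<kappa> / 2"
    using eventually_happens[OF eventually_conj[OF _ eventually_gt_at_top[of "0::real"]]] by auto
  have "0 < \<kappa> / (2 * T)"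
    using \<kappa> T by simp
  then obtain r where r: "0 < r" "\<And>z::'a. emeasure lborel (ball z r) \<le> ennreal (\<kappa> / (2 * T))"
    by (rule small_balls) blast
  have "emeasure (density_measure \<rho>) (ball z r) \<le> ennreal \<kappa>"
    if Lp: "in_Lp p \<rho>" "Lp_norm p \<rho> \<le> M" for \<rho> :: "'a \<Rightarrow> real" and z
  proof -
    have [measurable]: "\<rho> \<in> borel_measurable borel" and int: "integrable lborel (\<lambda>x. norm (\<rho> x) powr p)"
      using Lp by (auto simp: in_Lp_def)
    define I where "I = (LINT x|lborel. norm (\<rho> x) powr p)"
    have I: "0 \<le> I"
      by (simp add: I_def)
    have "I = (I powr (1 / p)) powr p"
      using I p by (simp add: powr_powr)
    also have "\<dots> \<le> max 0 M powr p"
      using Lp(2) p by (intro powr_mono2) (auto simp: Lp_norm_def I_def)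
    finally have I_le: "I \<le> B"
      by (simp add: B_def)
    have pw: "ennreal (\<rho> x) \<le> ennreal T + ennreal (T powr (1 - p)) * ennreal (norm (\<rho> x) powr p)" for x
    proof (cases "\<rho> x \<le> T")
      case True
      then show ?thesis
        by (intro add_increasing2) (auto intro: ennreal_leI)
    next
      case False
      \<comment> \<open>Above the level \<open>T\<close> the negative exponent \<open>1 - p\<close>
        allows replacing \<open>\<rho> x\<close> by \<open>T\<close> in the first factor.\<close>
      then have "\<rho> x = \<rho> x powr (1 - p) * \<rho> x powr p"
        using T by (simp add: powr_add[symmetric])
      also have "\<dots> \<le> T powr (1 - p) * \<rho> x powr p"
        using T False p by (intro mult_right_mono powr_mono2') auto
      finally have "ennreal (\<rho> x) \<le> ennreal (T powr (1 - p) * norm (\<rho> x) powr p)"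
        using T False by (intro ennreal_leI) auto
      then show ?thesis
        by (intro add_increasing) (simp_all add: ennreal_mult')
    qed
    have "emeasure (density_measure \<rho>) (ball z r) = (\<integral>\<^sup>+x. ennreal (\<rho> x) * indicator (ball z r) x \<partial>lborel)"
      by (subst emeasure_density) auto
    also have "\<dots> \<le> (\<integral>\<^sup>+x. ennreal T * indicator (ball z r) x + ennreal (T powr (1 - p)) * ennreal (norm (\<rho> x) powr p) \<partial>lborel)"
      using pw by (intro nn_integral_mono) (auto simp: indicator_def)
    also have "\<dots> = ennreal T * emeasure lborel (ball z r) + ennreal (T powr (1 - p)) * (\<integral>\<^sup>+x. ennreal (norm (\<rho> x) powr p) \<partial>lborel)"
    proof -
      have [measurable]: "ball z r \<in> sets borel"
        by simp
      show ?thesis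
        by (subst nn_integral_add) (simp_all add: nn_integral_cmult nn_integral_cmult_indicator)
    qed
    also have "(\<integral>\<^sup>+x. ennreal (norm (\<rho> x) powr p) \<partial>lborel) = ennreal I"
      unfolding I_def by (rule nn_integral_eq_integral[OF int]) simp
    also have "ennreal T * emeasure lborel (ball z r) + ennreal (T powr (1 - p)) * ennreal I
        \<le> ennreal T * ennreal (\<kappa> / (2 * T)) + ennreal (T powr (1 - p)) * ennreal B"
      by (intro add_mono mult_left_mono r ennreal_leI I_le) auto
    also have "\<dots> = ennreal (T * (\<kappa> / (2 * T)) + T powr (1 - p) * B)"
      using T \<kappa> B by (simp only: ennreal_plus ennreal_mult' ennreal_mult'' zero_le_mult_iff
          powr_ge_zero divide_nonneg_pos less_imp_le zero_less_mult_iff zero_less_numeral simp_thms)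
    also have "\<dots> \<le> ennreal \<kappa>"
      using T by (intro ennreal_leI) (simp add: mult.commute)
    finally show ?thesis .
  qed
  with r(1) show thesis
    by (rule that)
qed

section \<open>Polynomial multiples of a bump\<close>

text \<open>\<open>n = 0\<close> is the classical smooth function that is flat at the origin. The
  powers in the denominator are included because differentiation creates them; the family is closed
  under it up to linear combinations.\<close>

definition flat_exp :: "nat \<Rightarrow> real \<Rightarrow> real" where
  "flat_exp n t = (if t \<le> 0 then 0 else exp (- 1 / t) / t ^ n)"

lemma flat_exp_Suc: "flat_exp n t / t = flat_exp (Suc n) t"
  by (simp add: flat_exp_def)

lemma flat_exp_tendsto_0: "(flat_exp n \<longlongrightarrow> 0) (at 0)"
proof -
  have "((\<lambda>t::real. (inverse t) ^ n / exp (inverse t)) \<longlongrightarrow> 0) (at_right 0)"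
    by (rule filterlim_compose[OF tendsto_power_div_exp_0 filterlim_inverse_at_top_right])
  then have "(flat_exp n \<longlongrightarrow> 0) (at_right 0)"
    by (rule Lim_transform_eventually)
      (auto simp: eventually_at_filter flat_exp_def exp_minus field_simps)
  moreover have "(flat_exp n \<longlongrightarrow> 0) (at_left 0)"
    by (rule tendsto_eventually) (auto simp: eventually_at_filter flat_exp_def)
  ultimately show ?thesis
    by (rule filterlim_split_at_real[rotated])
qed

text \<open>The only delicate point is the origin: there the difference quotient is
  \<open>flat_exp (Suc n)\<close>, which tends to 0 because the exponential beats every
  power.\<close>

lemma DERIV_flat_exp:
  "(flat_exp n has_real_derivative flat_exp (n + 2) t - real n * flat_exp (n + 1) t) (at t)"
proof -
  consider "t < 0" | "t = 0" | "0 < t" by linarith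
  then show ?thesis
  proof cases
    case 1
    have "((\<lambda>_. 0) has_real_derivative 0) (at t)"
      by simp
    then have "(flat_exp n has_real_derivative 0) (at t)"
      by (rule has_field_derivative_transform_within_open[where S="{..<0}"]) (use 1 in \<open>auto simp: flat_exp_def\<close>)
    with 1 show ?thesis
      by (simp add: flat_exp_def)
  next
    case 2
    have "(flat_exp n has_real_derivative 0) (at 0)"
      using flat_exp_tendsto_0[of "Suc n"]
      by (simp add: has_field_derivative_iff flat_exp_Suc flat_exp_def[of n 0])
    with 2 show ?thesis
      by (simp add: flat_exp_def)
  next
    case 3
    have "((\<lambda>t. exp (- 1 / t) * inverse t ^ n) has_real_derivative
        flat_exp (n + 2) t - real n * flat_exp (n + 1) t) (at t)"
      using 3
      by (auto intro!: derivative_eq_intros simp: flat_exp_def field_simps power2_eq_square)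
         (cases n; simp add: field_simps)
    then show ?thesis
      by (rule has_field_derivative_transform_within_open[where S="{0<..}"])
        (use 3 in \<open>auto simp: flat_exp_def field_simps\<close>)
  qed
qed

lemma flat_exp_le_1: "0 \<le> flat_exp 0 t" "flat_exp 0 t \<le> 1"
  by (auto simp: flat_exp_def)

text \<open>For each fixed direction the derivative is again polynomial in the base point, so
  differentiating a bump only produces polynomial coefficients.\<close>

lemma real_polynomial_function_has_derivative:
  assumes "real_polynomial_function p"
  obtains p' where "\<And>x. (p has_derivative p' x) (at x)" "\<And>b. real_polynomial_function (\<lambda>x. p' x b)"
proof -
  have "\<exists>p'. (\<forall>x. (p has_derivative p' x) (at x)) \<and> (\<forall>b. real_polynomial_function (\<lambda>x. p' x b))"
    using assms
  proof induction
    case (linear f)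
    then show ?case
      by (intro exI[of _ "\<lambda>_. f"]) (auto intro: bounded_linear_imp_has_derivative)
  next
    case (const c)
    show ?case
      by (intro exI[of _ "\<lambda>_ _. 0"]) auto
  next
    case (add f g)
    then obtain f' g' where "\<And>x. (f has_derivative f' x) (at x)" "\<And>b. real_polynomial_function (\<lambda>x. f' x b)"
      "\<And>x. (g has_derivative g' x) (at x)" "\<And>b. real_polynomial_function (\<lambda>x. g' x b)"
      by auto
    then show ?case
      by (intro exI[of _ "\<lambda>x h. f' x h + g' x h"]) (auto intro: has_derivative_add)
  next
    case (mult f g)
    then obtain f' g' where "\<And>x. (f has_derivative f' x) (at x)" "\<And>b. real_polynomial_function (\<lambda>x. f' x b)"
      "\<And>x. (g has_derivative g' x) (at x)" "\<And>b. real_polynomial_function (\<lambda>x. g' x b)"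
      by auto
    with mult.hyps show ?case
      by (intro exI[of _ "\<lambda>x h. f x * g' x h + f' x h * g x"]) (auto intro!: has_derivative_mult real_polynomial_function.intros(3,4))
  qed
  then show thesis
    using that by blast
qed

lemma C_class_add:
  assumes "C_class k f" "C_class k g" shows "C_class k (\<lambda>x. f x + g x)"
  using assms
proof (induction k arbitrary: f g)
  case 0
  then show ?case
    by (auto intro: continuous_on_add)
next
  case (Suc k)
  have fd: "f differentiable at x" "g differentiable at x" for x
    using Suc.prems by (auto simp: differentiable_on_def)
  have "frechet_derivative (\<lambda>x. f x + g x) (at x) b
      = frechet_derivative f (at x) b + frechet_derivative g (at x) b" for x b
    by (subst frechet_derivative_at[symmetric, OF has_derivative_add])
      (use fd in \<open>auto simp: frechet_derivative_works[symmetric]\<close>)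
  then show ?case
    using Suc by (auto intro: differentiable_on_add)
qed

section \<open>Bumps as test functions\<close>

text \<open>A smooth function vanishing outside the ball of radius \<open>R\<close> around
  \<open>z\<close>. The polynomial factor \<open>p\<close> serves two purposes: it absorbs the
  coefficients created by differentiation, and it later allows approximation by
  Stone-Weierstrass.\<close>

definition bump :: "'a::euclidean_space \<Rightarrow> real \<Rightarrow> nat \<Rightarrow> ('a \<Rightarrow> real) \<Rightarrow> 'a \<Rightarrow> real" where
  "bump z R n p x = p x * flat_exp n (R\<^sup>2 - (x - z) \<bullet> (x - z))"

lemma bump_has_derivative:
  assumes "(p has_derivative p') (at x)"
  shows "(bump z R n p has_derivative (\<lambda>h. p x * ((- 2 * ((x - z) \<bullet> h)) *
     (flat_exp (n + 2) (R\<^sup>2 - (x - z) \<bullet> (x - z)) - real n * flat_exp (n + 1) (R\<^sup>2 - (x - z) \<bullet> (x - z))))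
     + p' h * flat_exp n (R\<^sup>2 - (x - z) \<bullet> (x - z)))) (at x)"
proof -
  have "((\<lambda>x. x - z) has_derivative (\<lambda>h. h)) (at x)"
    by (auto intro!: derivative_eq_intros)
  from has_derivative_diff[OF has_derivative_const[of "R\<^sup>2"] has_derivative_inner[OF this this]]
  have "((\<lambda>x. R\<^sup>2 - (x - z) \<bullet> (x - z)) has_derivative (\<lambda>h. 0 - ((x - z) \<bullet> h + h \<bullet> (x - z)))) (at x)" .
  moreover have "0 - ((x - z) \<bullet> h + h \<bullet> (x - z)) = - 2 * ((x - z) \<bullet> h)" for h
    using inner_commute[of h "x - z"] by linarith
  ultimately have "((\<lambda>x. R\<^sup>2 - (x - z) \<bullet> (x - z)) has_derivative (\<lambda>h. - 2 * ((x - z) \<bullet> h))) (at x)"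
    by (simp only:)
  from has_derivative_mult[OF assms DERIV_compose_FDERIV[OF DERIV_flat_exp this]] show ?thesis
    unfolding bump_def[abs_def] .
qed

lemma bump_differentiable:
  assumes "real_polynomial_function p"
  shows "bump z R n p differentiable (at x)"
proof -
  obtain p' where "\<And>x. (p has_derivative p' x) (at x)" "\<And>b. real_polynomial_function (\<lambda>x. p' x b)"
    using real_polynomial_function_has_derivative[OF assms] by blast
  from bump_has_derivative[OF this(1)] show ?thesis
    unfolding differentiable_def by blast
qed

text \<open>The chain rule raises \<open>n\<close> by at most 2 and multiplies by polynomials. Their
  exact form is irrelevant later, so they are only asserted to exist.\<close>

lemma frechet_derivative_bump:
  assumes "real_polynomial_function p"
  obtains q\<^sub>0 q\<^sub>1 q\<^sub>2 where "real_polynomial_function q\<^sub>0" "real_polynomial_function q\<^sub>1" "real_polynomial_function q\<^sub>2"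
    "(\<lambda>x. frechet_derivative (bump z R n p) (at x) b) =
      (\<lambda>x. bump z R n q\<^sub>0 x + (bump z R (n + 1) q\<^sub>1 x + bump z R (n + 2) q\<^sub>2 x))"
proof -
  obtain p' where p': "\<And>x. (p has_derivative p' x) (at x)" "\<And>b. real_polynomial_function (\<lambda>x. p' x b)"
    using real_polynomial_function_has_derivative[OF assms] by blast
  note d = bump_has_derivative[OF p'(1)]
  have "real_polynomial_function (\<lambda>x. x \<bullet> b - z \<bullet> b)"
    by (intro real_polynomial_function_diff real_polynomial_function.intros bounded_linear_inner_left)
  then have inner: "real_polynomial_function (\<lambda>x. (x - z) \<bullet> b)"
    by (simp add: inner_diff_left)
  show thesis
  proof (rule that)
    show "real_polynomial_function (\<lambda>x. p' x b)"
      by (rule p')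
    show "real_polynomial_function (\<lambda>x. p x * (2 * real n * ((x - z) \<bullet> b)))"
      "real_polynomial_function (\<lambda>x. p x * (- 2 * ((x - z) \<bullet> b)))"
      using assms inner by (intro real_polynomial_function.intros(2,4); simp)+
    show "(\<lambda>x. frechet_derivative (bump z R n p) (at x) b) =
      (\<lambda>x. bump z R n (\<lambda>x. p' x b) x + (bump z R (n + 1) (\<lambda>x. p x * (2 * real n * ((x - z) \<bullet> b))) x +
       bump z R (n + 2) (\<lambda>x. p x * (- 2 * ((x - z) \<bullet> b))) x))"
      unfolding frechet_derivative_at[OF d, symmetric] by (simp add: bump_def algebra_simps)
  qed
qed

text \<open>Induction on the order with \<open>p\<close> and \<open>n\<close> kept general, because
  a derivative of a bump is a sum of three bumps with other polynomials and exponents.\<close>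

lemma C_class_bump:
  assumes "real_polynomial_function p"
  shows "C_class k (bump z R n p)"
  using assms
proof (induction k arbitrary: p n)
  case 0
  then have "bump z R n p differentiable_on UNIV"
    by (intro differentiable_at_imp_differentiable_on bump_differentiable)
  then show ?case
    by (simp add: differentiable_imp_continuous_on)
next
  case (Suc k)
  have "C_class k (\<lambda>x. frechet_derivative (bump z R n p) (at x) b)" for b
    by (rule frechet_derivative_bump[OF Suc.prems, of z R n b]) (simp only:, intro C_class_add Suc.IH)
  moreover have "bump z R n p differentiable_on UNIV"
    using Suc.prems by (intro differentiable_at_imp_differentiable_on bump_differentiable)
  ultimately show ?case
    by simp
qed

lemma bump_eq_0: "R \<le> dist x z \<Longrightarrow> 0 \<le> R \<Longrightarrow> bump z R n p x = 0"
proof -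
  assume "R \<le> dist x z" "0 \<le> R"
  then have "R\<^sup>2 \<le> (x - z) \<bullet> (x - z)"
    by (metis dist_norm power2_norm_eq_inner power_mono)
  then show ?thesis
    by (simp add: bump_def flat_exp_def)
qed

lemma test_function_bump:
  assumes "real_polynomial_function p" "0 \<le> R"
  shows "test_function (bump z R n p)"
proof -
  have "{x. bump z R n p x \<noteq> 0} \<subseteq> cball z R"
    using bump_eq_0[of R _ z n p] assms(2) by (force simp: dist_commute)
  then have "compact (closure {x. bump z R n p x \<noteq> 0})"
    by (metis bounded_cball bounded_subset compact_closure)
  then show ?thesis
    using C_class_bump[OF assms(1)] by (simp add: test_function_def)
qed

lemma continuous_bump:
  assumes "real_polynomial_function p"
  shows "continuous_on UNIV (bump z R n p)"
  using C_class_bump[OF assms, of 0 z R n] by simp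

lemma bump_measurable:
  assumes "real_polynomial_function p"
  shows "bump z R n p \<in> borel_measurable borel"
  by (rule borel_measurable_continuous_onI[OF continuous_bump[OF assms]])

lemma bump_bounded:
  assumes p: "real_polynomial_function p" and R: "0 \<le> R"
  obtains C where "0 \<le> C" "\<And>x. \<bar>bump z R n p x\<bar> \<le> C"
proof -
  have "compact (bump z R n p ` cball z R)"
    by (intro compact_continuous_image continuous_on_subset[OF continuous_bump[OF p]]) auto
  then obtain C where C: "\<And>y. y \<in> bump z R n p ` cball z R \<Longrightarrow> norm y \<le> C"
    using compact_imp_bounded bounded_iff by metis
  have "\<bar>bump z R n p x\<bar> \<le> max 0 C" for x
  proof (cases "x \<in> cball z R")
    case True
    then show ?thesis
      using C[of "bump z R n p x"] by auto
  next
    case False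
    then show ?thesis
      using bump_eq_0[of R x z n p] R by (simp add: dist_commute)
  qed
  then show thesis
    by (intro that[of "max 0 C"]) auto
qed

lemma real_polynomial_function_translate:
  "real_polynomial_function p \<Longrightarrow> real_polynomial_function (\<lambda>x. p (x - c))"
  using real_polynomial_function_compose[of "\<lambda>x. x - c" p]
  by (simp add: comp_def polynomial_function_diff)

text \<open>Translates of bumps are bumps, so integrability and the test function property carry
  over to them.\<close>

lemma bump_translate: "bump z R n p (x - c) = bump (z + c) R n (\<lambda>x. p (x - c)) x"
  by (simp add: bump_def algebra_simps)

section \<open>Integrals against translated bumps\<close>

lemma loc_integrable_mult:
  fixes u :: "'a::euclidean_space \<Rightarrow> real"
  assumes u: "loc_integrable u" and [measurable]: "f \<in> borel_measurable borel"
    and bound: "\<And>x. \<bar>f x\<bar> \<le> C" and supp: "\<And>x. x \<notin> cball z \<rho> \<Longrightarrow> f x = 0"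
  shows "integrable lborel (\<lambda>x. u x * f x)"
proof (rule Bochner_Integration.integrable_bound)
  have [measurable]: "u \<in> borel_measurable borel"
    using u by (simp add: loc_integrable_def)
  have "set_integrable lborel (cball z \<rho>) u"
    using u compact_cball[of z \<rho>] unfolding loc_integrable_def by blast
  then show "integrable lborel (\<lambda>x. C * (indicator (cball z \<rho>) x *\<^sub>R u x))"
    unfolding set_integrable_def by simp
  show "(\<lambda>x. u x * f x) \<in> borel_measurable lborel"
    by measurable
  have "norm (u x * f x) \<le> norm (C * (indicator (cball z \<rho>) x *\<^sub>R u x))" for x
  proof (cases "x \<in> cball z \<rho>")
    case True
    have "norm (u x * f x) \<le> \<bar>u x\<bar> * C"
      using bound[of x] by (simp add: abs_mult mult_left_mono)
    also have "\<dots> \<le> \<bar>u x\<bar> * \<bar>C\<bar>"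
      by (intro mult_left_mono) auto
    finally show ?thesis
      using True by (simp add: abs_mult mult.commute)
  qed (simp add: supp)
  then show "AE x in lborel. norm (u x * f x) \<le> norm (C * (indicator (cball z \<rho>) x *\<^sub>R u x))"
    by simp
qed

lemma integrable_bump_mult:
  fixes u :: "'a::euclidean_space \<Rightarrow> real"
  assumes u: "loc_integrable u" and p: "real_polynomial_function p" and R: "0 \<le> R"
  shows "integrable lborel (\<lambda>x. u x * bump z R n p x)"
proof -
  obtain C where C: "\<And>x. \<bar>bump z R n p x\<bar> \<le> C"
    using bump_bounded[OF p R] by blast
  show ?thesis
    using bump_eq_0[of R _ z n p] R
    by (intro loc_integrable_mult[OF u bump_measurable[OF p] C, of z R]) (auto simp: dist_commute)
qed

lemma loc_integrable_bump:
  assumes p: "real_polynomial_function p"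
  shows "loc_integrable (bump z R n p :: 'a::euclidean_space \<Rightarrow> real)"
  unfolding loc_integrable_def
  unfolding set_integrable_def
  using bump_measurable[OF p] continuous_on_subset[OF continuous_bump[OF p]]
  by (intro conjI allI impI borel_integrable_compact) simp_all

lemma bump_shift_DERIV:
  fixes z e :: "'a::euclidean_space"
  assumes p: "real_polynomial_function p"
  shows "((\<lambda>t. bump z R n p (x - t *\<^sub>R e)) has_real_derivative
    - frechet_derivative (bump z R n p) (at (x - t *\<^sub>R e)) e) (at t)"
proof -
  let ?D = "frechet_derivative (bump z R n p) (at (x - t *\<^sub>R e))"
  have D: "(bump z R n p has_derivative ?D) (at (x - t *\<^sub>R e))"
    using bump_differentiable[OF p] by (simp add: frechet_derivative_works)
  then interpret D: bounded_linear ?D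
    by (rule has_derivative_bounded_linear)
  have "((\<lambda>t. x - t *\<^sub>R e) has_derivative (\<lambda>h. (- h) *\<^sub>R e)) (at t)"
    by (auto intro!: derivative_eq_intros)
  from has_derivative_compose[OF this D]
  have "((\<lambda>t. bump z R n p (x - t *\<^sub>R e)) has_derivative (\<lambda>h. ?D ((- h) *\<^sub>R e))) (at t)" .
  then show ?thesis
    unfolding has_field_derivative_def
    by (rule has_derivative_eq_rhs) (rule ext, simp only: D.scaleR, simp)
qed

text \<open>The shift is put on the bump, since \<open>u\<close> need not be differentiable. Its
  directional derivative is a sum of three bumps and hence bounded by some \<open>C\<close>, which
  also bounds the difference quotients; dominated convergence along sequences then applies.\<close>

lemma DERIV_shift_integral:
  fixes u :: "'a::euclidean_space \<Rightarrow> real"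
  assumes u: "loc_integrable u" and p: "real_polynomial_function p" and R: "0 \<le> R" and e: "norm e = 1"
  shows "((\<lambda>t. LINT x|lborel. u x * bump z R n p (x - t *\<^sub>R e)) has_real_derivative
    - (LINT x|lborel. u x * frechet_derivative (bump z R n p) (at (x - t *\<^sub>R e)) e)) (at t)"
proof -
  let ?\<psi> = "bump z R n p"
  define D where "D y = frechet_derivative ?\<psi> (at y) e" for y
  obtain q0 q1 q2 where q: "real_polynomial_function q0" "real_polynomial_function q1" "real_polynomial_function q2"
    and "(\<lambda>x. frechet_derivative ?\<psi> (at x) e) = (\<lambda>x. bump z R n q0 x + (bump z R (n + 1) q1 x + bump z R (n + 2) q2 x))"
    by (rule frechet_derivative_bump[OF p])
  then have D_eq: "D = (\<lambda>x. bump z R n q0 x + (bump z R (n + 1) q1 x + bump z R (n + 2) q2 x))"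
    by (simp only: D_def[abs_def])
  have [measurable]: "u \<in> borel_measurable borel"
    using u by (simp add: loc_integrable_def)
  have [measurable]: "?\<psi> \<in> borel_measurable borel"
    by (rule bump_measurable[OF p])
  have [measurable]: "D \<in> borel_measurable borel"
    unfolding D_eq by (intro borel_measurable_add bump_measurable q)
  obtain C0 where "\<And>x. \<bar>bump z R n q0 x\<bar> \<le> C0"
    using bump_bounded[OF q(1) R] by blast
  moreover obtain C1 where "\<And>x. \<bar>bump z R (n + 1) q1 x\<bar> \<le> C1"
    using bump_bounded[OF q(2) R] by blast
  moreover obtain C2 where "\<And>x. \<bar>bump z R (n + 2) q2 x\<bar> \<le> C2"
    using bump_bounded[OF q(3) R] by blast
  ultimately have "\<bar>D x\<bar> \<le> C0 + (C1 + C2)" for x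
    unfolding D_eq by (intro order_trans[OF abs_triangle_ineq] add_mono) auto
  then obtain C where C: "\<And>x. \<bar>D x\<bar> \<le> C"
    by blast
  have C0: "0 \<le> C"
    using C[of 0] by linarith
  have \<psi>_DERIV: "((\<lambda>t. ?\<psi> (x - t *\<^sub>R e)) has_real_derivative - D (x - t *\<^sub>R e)) (at t)" for x t
    unfolding D_def by (rule bump_shift_DERIV[OF p])
  have lip: "\<bar>?\<psi> (x - s *\<^sub>R e) - ?\<psi> (x - t *\<^sub>R e)\<bar> \<le> C * \<bar>s - t\<bar>" for x s t
    using field_differentiable_bound[of UNIV "\<lambda>t. ?\<psi> (x - t *\<^sub>R e)" "\<lambda>t. - D (x - t *\<^sub>R e)" C s t]
      \<psi>_DERIV C by simp
  have supp: "?\<psi> (x - s *\<^sub>R e) = 0" if "x \<notin> cball z (R + H)" "\<bar>s\<bar> \<le> H" for x s H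
  proof (rule bump_eq_0[OF _ R])
    have "norm (x - z) \<le> norm (x - s *\<^sub>R e - z) + norm (s *\<^sub>R e)"
      using norm_triangle_ineq[of "x - s *\<^sub>R e - z" "s *\<^sub>R e"] by simp
    then show "R \<le> dist (x - s *\<^sub>R e) z"
      using that e by (simp add: dist_norm norm_minus_commute)
  qed
  have int: "integrable lborel (\<lambda>x. u x * ?\<psi> (x - s *\<^sub>R e))" for s
    unfolding bump_translate by (intro integrable_bump_mult u R real_polynomial_function_translate p)
  let ?\<Phi> = "\<lambda>t. LINT x|lborel. u x * ?\<psi> (x - t *\<^sub>R e)"
  have "((\<lambda>s. (?\<Phi> s - ?\<Phi> t) / (s - t)) \<longlongrightarrow> (LINT x|lborel. u x * - D (x - t *\<^sub>R e))) (at t)"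
    unfolding tendsto_at_iff_sequentially
  proof (intro allI impI)
    fix X :: "nat \<Rightarrow> real" assume X: "\<forall>i. X i \<in> UNIV - {t}" "X \<longlonglongrightarrow> t"
    have "Bseq X"
      using X(2) by (intro convergent_imp_Bseq convergentI)
    then obtain H0 where "\<And>i. norm (X i) \<le> H0"
      using BseqD by blast
    \<comment> \<open>One \<open>H\<close> bounds \<open>t\<close> and all shifts of the sequence,
      so every difference quotient vanishes outside the same ball of radius \<open>R + H\<close>, on
      which \<open>u\<close> is integrable.\<close>
    then have "\<And>i. \<bar>X i\<bar> \<le> max H0 \<bar>t\<bar>" "\<bar>t\<bar> \<le> max H0 \<bar>t\<bar>"
      by (auto simp: max.coboundedI1)
    then obtain H where H: "\<And>i. \<bar>X i\<bar> \<le> H" "\<bar>t\<bar> \<le> H"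
      by blast
    let ?q = "\<lambda>i x. u x * ((?\<psi> (x - X i *\<^sub>R e) - ?\<psi> (x - t *\<^sub>R e)) / (X i - t))"
    let ?w = "\<lambda>x. C * \<bar>indicator (cball z (R + H)) x *\<^sub>R u x\<bar>"
    have "(\<lambda>i. LINT x|lborel. ?q i x) \<longlonglongrightarrow> (LINT x|lborel. u x * - D (x - t *\<^sub>R e))"
    proof (rule integral_dominated_convergence[where w="?w"])
      have "set_integrable lborel (cball z (R + H)) u"
        using u compact_cball[of z "R + H"] unfolding loc_integrable_def by blast
      then show "integrable lborel ?w"
        unfolding set_integrable_def by (intro integrable_mult_right integrable_abs)
      show "AE x in lborel. (\<lambda>i. ?q i x) \<longlonglongrightarrow> u x * - D (x - t *\<^sub>R e)"
      proof (intro AE_I2 tendsto_mult tendsto_const)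
        fix x
        have "((\<lambda>s. (?\<psi> (x - s *\<^sub>R e) - ?\<psi> (x - t *\<^sub>R e)) / (s - t)) \<longlongrightarrow> - D (x - t *\<^sub>R e)) (at t)"
          using \<psi>_DERIV[of x t] by (simp add: has_field_derivative_iff)
        then show "(\<lambda>i. (?\<psi> (x - X i *\<^sub>R e) - ?\<psi> (x - t *\<^sub>R e)) / (X i - t)) \<longlonglongrightarrow> - D (x - t *\<^sub>R e)"
          unfolding tendsto_at_iff_sequentially using X by (auto simp: comp_def)
      qed
      show "AE x in lborel. norm (?q i x) \<le> ?w x" for i
      proof (intro AE_I2)
        fix x
        show "norm (?q i x) \<le> ?w x"
        proof (cases "x \<in> cball z (R + H)")
          case True
          have "\<bar>(?\<psi> (x - X i *\<^sub>R e) - ?\<psi> (x - t *\<^sub>R e)) / (X i - t)\<bar> \<le> C"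
            using lip[of x "X i" t] X(1) by (simp add: field_simps)
          then have "\<bar>u x\<bar> * \<bar>(?\<psi> (x - X i *\<^sub>R e) - ?\<psi> (x - t *\<^sub>R e)) / (X i - t)\<bar> \<le> \<bar>u x\<bar> * C"
            by (intro mult_left_mono) auto
          then show ?thesis
            using True by (simp add: abs_mult mult.commute)
        next
          case False
          then show ?thesis
            using supp[OF False H(1)] supp[OF False H(2)] by simp
        qed
      qed
    qed measurable
    moreover have "(?\<Phi> (X i) - ?\<Phi> t) / (X i - t) = (LINT x|lborel. ?q i x)" for i
    proof -
      have "(LINT x|lborel. ?q i x) = (LINT x|lborel. (u x * ?\<psi> (x - X i *\<^sub>R e) - u x * ?\<psi> (x - t *\<^sub>R e)) / (X i - t))"
        by (simp add: right_diff_distrib)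
      also have "\<dots> = (?\<Phi> (X i) - ?\<Phi> t) / (X i - t)"
        using int by simp
      finally show ?thesis ..
    qed
    ultimately show "((\<lambda>s. (?\<Phi> s - ?\<Phi> t) / (s - t)) \<circ> X) \<longlonglongrightarrow> (LINT x|lborel. u x * - D (x - t *\<^sub>R e))"
      by (simp only: comp_def)
  qed
  then show ?thesis
    by (simp add: has_field_derivative_iff D_def)
qed

section \<open>Concentration in \<open>H\<^sup>1\<close>\<close>

text \<open>The translated bump is itself a test function, and its derivative is the translate of
  the derivative, so the definition of the weak gradient applies.\<close>

lemma weak_gradient_shift:
  fixes z e :: "'a::euclidean_space"
  assumes wg: "has_weak_gradient u g" and p: "real_polynomial_function p" and R: "0 \<le> R" and e: "e \<in> Basis"
  shows "(LINT x|lborel. u x * frechet_derivative (bump z R n p) (at (x - c)) e) =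
    - (LINT x|lborel. (g x \<bullet> e) * bump z R n p (x - c))"
proof -
  let ?\<psi> = "bump (z + c) R n (\<lambda>x. p (x - c))"
  have \<psi>: "?\<psi> = (\<lambda>x. bump z R n p (x - c))"
    by (simp add: bump_translate fun_eq_iff)
  have "frechet_derivative ?\<psi> (at x) = frechet_derivative (bump z R n p) (at (x - c))" for x
  proof -
    have D: "(bump z R n p has_derivative frechet_derivative (bump z R n p) (at (x - c))) (at (x - c))"
      using bump_differentiable[OF p] by (simp add: frechet_derivative_works)
    have "((\<lambda>x. x - c) has_derivative (\<lambda>h. h)) (at x)"
      by (auto intro!: derivative_eq_intros)
    from has_derivative_compose[OF this D]
    have "(?\<psi> has_derivative frechet_derivative (bump z R n p) (at (x - c))) (at x)"
      unfolding \<psi> .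
    then show ?thesis
      by (rule frechet_derivative_at[symmetric])
  qed
  moreover have "test_function ?\<psi>"
    by (intro test_function_bump real_polynomial_function_translate p R)
  ultimately show ?thesis
    using wg e unfolding has_weak_gradient_def by (metis (no_types, lifting) Bochner_Integration.integral_cong \<psi>)
qed

lemma integrable_bump_square:
  assumes "real_polynomial_function p" "0 \<le> R"
  shows "integrable lborel (\<lambda>x::'a::euclidean_space. (bump z R n p x)\<^sup>2)"
  using integrable_bump_mult[OF loc_integrable_bump[OF assms(1)] assms]
  by (simp add: power2_eq_square)

lemma integral_shift:
  fixes f :: "'a::euclidean_space \<Rightarrow> real"
  assumes [measurable]: "f \<in> borel_measurable borel"
  shows "(LINT x|lborel. f (x - c)) = (LINT x|lborel. f x)"
proof -
  have "(LINT x|lborel. f x) = (LINT x|distr lborel borel ((+) (- c)). f x)"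
    by (simp add: lborel_distr_plus)
  also have "\<dots> = (LINT x|lborel. f (- c + x))"
    by (subst integral_distr) auto
  finally show ?thesis
    by simp
qed

text \<open>The integral of \<open>u\<close> against the shifted bump is differentiable in the
  shift, and the weak gradient turns its derivative into an integral of \<open>g \<bullet> e\<close>
  against the bump. The inequality between a product and half the sum of squares bounds it
  uniformly, by translation invariance, and the mean value inequality concludes.\<close>

lemma shift_estimate:
  fixes u :: "'a::euclidean_space \<Rightarrow> real"
  assumes wg: "has_weak_gradient u g" and g2: "integrable lborel (\<lambda>x. (norm (g x))\<^sup>2)"
    and p: "real_polynomial_function p" and R: "0 \<le> R" and e: "e \<in> Basis" and T: "0 \<le> T"
  shows "\<bar>(LINT x|lborel. u x * bump z R n p (x - T *\<^sub>R e)) - (LINT x|lborel. u x * bump z R n p x)\<bar>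
    \<le> T * ((LINT x|lborel. (norm (g x))\<^sup>2) / 2 + (LINT x|lborel. (bump z R n p x)\<^sup>2) / 2)"
proof -
  let ?\<psi> = "bump z R n p"
  let ?B = "(LINT x|lborel. (norm (g x))\<^sup>2) / 2 + (LINT x|lborel. (?\<psi> x)\<^sup>2) / 2"
  have u: "loc_integrable u" and [measurable]: "g \<in> borel_measurable borel"
    using wg unfolding has_weak_gradient_def loc_integrable_def by blast+
  have [measurable]: "?\<psi> \<in> borel_measurable borel"
    by (rule bump_measurable[OF p])
  have \<psi>2: "integrable lborel (\<lambda>x. (?\<psi> (x - c))\<^sup>2)" for c
    unfolding bump_translate by (intro integrable_bump_square real_polynomial_function_translate p R)
  have bound: "norm (LINT x|lborel. (g x \<bullet> e) * ?\<psi> (x - c)) \<le> ?B" for c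
  proof -
    have sum_int: "integrable lborel (\<lambda>x. (norm (g x))\<^sup>2 / 2 + (?\<psi> (x - c))\<^sup>2 / 2)"
      using g2 \<psi>2 by simp
    have pw: "norm ((g x \<bullet> e) * ?\<psi> (x - c)) \<le> (norm (g x))\<^sup>2 / 2 + (?\<psi> (x - c))\<^sup>2 / 2" for x
    proof -
      have "\<bar>g x \<bullet> e\<bar> \<le> norm (g x)"
        using e Basis_le_norm by auto
      then have "norm ((g x \<bullet> e) * ?\<psi> (x - c)) \<le> norm (g x) * \<bar>?\<psi> (x - c)\<bar>"
        by (simp add: abs_mult mult_right_mono)
      also have "\<dots> \<le> (norm (g x))\<^sup>2 / 2 + (?\<psi> (x - c))\<^sup>2 / 2"
        using sum_squares_bound[of "norm (g x)" "\<bar>?\<psi> (x - c)\<bar>"] by simp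
      finally show ?thesis .
    qed
    have "integrable lborel (\<lambda>x. (g x \<bullet> e) * ?\<psi> (x - c))"
    proof (rule Bochner_Integration.integrable_bound[OF sum_int])
      show "AE x in lborel. norm ((g x \<bullet> e) * ?\<psi> (x - c)) \<le> norm ((norm (g x))\<^sup>2 / 2 + (?\<psi> (x - c))\<^sup>2 / 2)"
        using pw by (intro AE_I2) (metis abs_ge_self order_trans real_norm_def)
    qed measurable
    then have "norm (LINT x|lborel. (g x \<bullet> e) * ?\<psi> (x - c))
        \<le> (LINT x|lborel. (norm (g x))\<^sup>2 / 2 + (?\<psi> (x - c))\<^sup>2 / 2)"
      using sum_int pw by (intro order_trans[OF integral_norm_bound] integral_mono) auto
    also have "\<dots> = (LINT x|lborel. (norm (g x))\<^sup>2) / 2 + (LINT x|lborel. (?\<psi> (x - c))\<^sup>2) / 2"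
      using g2 \<psi>2 by simp
    also have "(LINT x|lborel. (?\<psi> (x - c))\<^sup>2) = (LINT x|lborel. (?\<psi> x)\<^sup>2)"
      by (rule integral_shift[where f="\<lambda>x. (?\<psi> x)\<^sup>2"]) measurable
    finally show ?thesis .
  qed
  have e1: "norm e = 1"
    using e by simp
  let ?\<Phi> = "\<lambda>t. LINT x|lborel. u x * ?\<psi> (x - t *\<^sub>R e)"
  have D: "(?\<Phi> has_field_derivative (LINT x|lborel. (g x \<bullet> e) * ?\<psi> (x - t *\<^sub>R e))) (at t within UNIV)" for t
    using DERIV_shift_integral[OF u p R e1, of z n t] unfolding weak_gradient_shift[OF wg p R e] by simp
  have "norm (?\<Phi> T - ?\<Phi> 0) \<le> ?B * norm (T - 0)"
    by (rule field_differentiable_bound[OF convex_UNIV D bound]) auto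
  then show ?thesis
    using T by (simp add: mult.commute)
qed

text \<open>Some \<open>k < K\<close> has at most \<open>1 / K\<close> of the mass of \<open>u\<^sup>2\<close> on the ball translated by \<open>2 R k e\<close>, and
  moving the bump there costs at most the length of the shift times the gradient.\<close>

lemma weak_bound:
  fixes u :: "'a::euclidean_space \<Rightarrow> real"
  assumes wg: "has_weak_gradient u g" and u2: "integrable lborel (\<lambda>x. (u x)\<^sup>2)"
    and g2: "integrable lborel (\<lambda>x. (norm (g x))\<^sup>2)"
    and p: "real_polynomial_function p" and R: "0 < R" and K: "0 < K" and RK: "2 * R * real K \<le> 1 / 2"
  shows "(LINT x|lborel. u x * bump z R n p x) \<le>
    (LINT x|lborel. (u x)\<^sup>2) / (2 * real K) + R * real K * (LINT x|lborel. (norm (g x))\<^sup>2)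
      + 3 / 4 * (LINT x|lborel. (bump z R n p x)\<^sup>2)"
proof -
  let ?\<psi> = "bump z R n p"
  define a b q where "a = (LINT x|lborel. (u x)\<^sup>2)" and "b = (LINT x|lborel. (norm (g x))\<^sup>2)"
    and "q = (LINT x|lborel. (?\<psi> x)\<^sup>2)"
  have q0: "0 \<le> q" and b0: "0 \<le> b"
    by (simp_all add: q_def b_def)
  obtain e :: 'a where e: "e \<in> Basis"
    using nonempty_Basis by blast
  have u: "loc_integrable u"
    using wg unfolding has_weak_gradient_def by blast
  then have [measurable]: "u \<in> borel_measurable borel"
    unfolding loc_integrable_def by blast
  have [measurable]: "?\<psi> \<in> borel_measurable borel"
    by (rule bump_measurable[OF p])
  \<comment> \<open>Consecutive centres are \<open>2 * R\<close> apart, so the open balls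
    \<open>S k\<close> of radius \<open>R\<close> are disjoint.\<close>
  define T where "T k = 2 * R * real k" for k
  define S where "S k = ball (z + T k *\<^sub>R e) R" for k
  have [measurable]: "S k \<in> sets borel" for k
    by (simp add: S_def)
  have disj: "k = l" if "x \<in> S k" "x \<in> S l" for k l x
  proof (rule ccontr)
    assume "k \<noteq> l"
    then have "1 \<le> \<bar>real k - real l\<bar>"
      by linarith
    then have "2 * R * 1 \<le> 2 * R * \<bar>real k - real l\<bar>"
      using R by (intro mult_left_mono) auto
    also have "\<dots> = \<bar>T k - T l\<bar>"
      using R by (simp add: T_def abs_mult flip: right_diff_distrib)
    also have "\<dots> = dist (z + T k *\<^sub>R e) (z + T l *\<^sub>R e)"
      using e by (simp add: dist_norm flip: scaleR_diff_left)
    also have "\<dots> < R + R"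
      using that dist_triangle[of "z + T k *\<^sub>R e" "z + T l *\<^sub>R e" x] by (auto simp: S_def dist_commute)
    finally show False
      by simp
  qed
  have int_S: "integrable lborel (\<lambda>x. indicator (S k) x * (u x)\<^sup>2)" for k
    using integrable_real_mult_indicator[of "S k" lborel "\<lambda>x. (u x)\<^sup>2"] u2 by (simp add: mult.commute)
  have ind: "(\<Sum>k<K. indicator (S k) x) \<le> (1::real)" for x
  proof (cases "\<exists>k<K. x \<in> S k")
    case True
    then obtain k where k: "k < K" "x \<in> S k"
      by blast
    have "indicator (S l) x = (if l = k then 1 else (0::real))" for l
      using disj[OF k(2), of l] k(2) by (cases "l = k") (auto simp: indicator_def)
    then have "(\<Sum>l<K. indicator (S l) x) = (\<Sum>l<K. if l = k then 1 else (0::real))"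
      by (intro sum.cong refl)
    then show ?thesis
      using k by simp
  qed (auto intro!: sum_nonpos[THEN order_trans] simp: indicator_def)
  have "(\<Sum>k<K. LINT x|lborel. indicator (S k) x * (u x)\<^sup>2) = (LINT x|lborel. (\<Sum>k<K. indicator (S k) x) * (u x)\<^sup>2)"
    unfolding sum_distrib_right by (rule Bochner_Integration.integral_sum[symmetric]) (rule int_S)
  also have "\<dots> \<le> (LINT x|lborel. 1 * (u x)\<^sup>2)"
  proof (intro integral_mono mult_right_mono ind)
    show "integrable lborel (\<lambda>x. (\<Sum>k<K. indicator (S k) x) * (u x)\<^sup>2)"
      unfolding sum_distrib_right by (intro Bochner_Integration.integrable_sum int_S)
  qed (use u2 in simp_all)
  finally have sum_le: "(\<Sum>k<K. LINT x|lborel. indicator (S k) x * (u x)\<^sup>2) \<le> a"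
    by (simp add: a_def)
  \<comment> \<open>Pigeonhole: otherwise the \<open>K\<close> disjoint balls together would carry
    more than the total \<open>a\<close>.\<close>
  obtain k where k: "k < K" "(LINT x|lborel. indicator (S k) x * (u x)\<^sup>2) \<le> a / real K"
  proof (rule ccontr)
    assume "\<not> thesis"
    then have "a / real K < (LINT x|lborel. indicator (S k) x * (u x)\<^sup>2)" if "k < K" for k
      using that \<open>\<And>k. k < K \<Longrightarrow> _ \<Longrightarrow> thesis\<close> by force
    then have "(\<Sum>k<K. a / real K) < (\<Sum>k<K. LINT x|lborel. indicator (S k) x * (u x)\<^sup>2)"
      using K by (intro sum_strict_mono) auto
    then show False
      using sum_le K by simp
  qed
  have Tk: "0 \<le> T k" "T k \<le> 2 * R * real K" "T k \<le> 1 / 2"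
  proof -
    show "0 \<le> T k" and *: "T k \<le> 2 * R * real K"
      using R k(1) by (auto simp: T_def)
    show "T k \<le> 1 / 2"
      using * RK by linarith
  qed
  have \<psi>2: "integrable lborel (\<lambda>x. (?\<psi> (x - T k *\<^sub>R e))\<^sup>2)"
    unfolding bump_translate using R by (intro integrable_bump_square real_polynomial_function_translate p) simp
  have "(LINT x|lborel. u x * ?\<psi> (x - T k *\<^sub>R e))
      \<le> (LINT x|lborel. (indicator (S k) x * (u x)\<^sup>2) / 2 + (?\<psi> (x - T k *\<^sub>R e))\<^sup>2 / 2)"
  proof (intro integral_mono)
    show "integrable lborel (\<lambda>x. u x * ?\<psi> (x - T k *\<^sub>R e))"
      unfolding bump_translate using R by (intro integrable_bump_mult u real_polynomial_function_translate p) simp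
    show "integrable lborel (\<lambda>x. (indicator (S k) x * (u x)\<^sup>2) / 2 + (?\<psi> (x - T k *\<^sub>R e))\<^sup>2 / 2)"
      using int_S \<psi>2 by simp
    fix x
    show "u x * ?\<psi> (x - T k *\<^sub>R e) \<le> (indicator (S k) x * (u x)\<^sup>2) / 2 + (?\<psi> (x - T k *\<^sub>R e))\<^sup>2 / 2"
    proof (cases "x \<in> S k")
      case True
      then show ?thesis
        using sum_squares_bound[of "u x" "?\<psi> (x - T k *\<^sub>R e)"] by simp
    next
      case False
      then have "R \<le> dist (x - T k *\<^sub>R e) z"
        by (simp add: S_def dist_norm norm_minus_commute algebra_simps)
      then have "?\<psi> (x - T k *\<^sub>R e) = 0"
        using R by (intro bump_eq_0) auto
      then show ?thesis
        by simp
    qed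
  qed
  also have "\<dots> = (LINT x|lborel. indicator (S k) x * (u x)\<^sup>2) / 2 + (LINT x|lborel. (?\<psi> (x - T k *\<^sub>R e))\<^sup>2) / 2"
    using int_S \<psi>2 by simp
  also have "(LINT x|lborel. (?\<psi> (x - T k *\<^sub>R e))\<^sup>2) = q"
    unfolding q_def by (rule integral_shift[where f="\<lambda>x. (?\<psi> x)\<^sup>2"]) measurable
  finally have far: "(LINT x|lborel. u x * ?\<psi> (x - T k *\<^sub>R e)) \<le> a / (2 * real K) + q / 2"
    using k(2) by simp
  have "\<bar>(LINT x|lborel. u x * ?\<psi> (x - T k *\<^sub>R e)) - (LINT x|lborel. u x * ?\<psi> x)\<bar> \<le> T k * (b / 2 + q / 2)"
    unfolding b_def q_def using R Tk(1) by (intro shift_estimate[OF wg g2 p _ e]) auto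
  \<comment> \<open>The shift is bounded twice: by \<open>2 * R * real K\<close> in the gradient
    term and by 1/2 in the bump term. The resulting \<open>q / 4\<close> and the
    \<open>q / 2\<close> from the far ball add up to 3/4 of \<open>q\<close>; a factor below 1 is
    what lets this term be absorbed later.\<close>
  moreover have "T k * (b / 2 + q / 2) \<le> R * real K * b + q / 4"
  proof -
    have "T k * b \<le> 2 * R * real K * b" "T k * q \<le> 1 / 2 * q"
      using Tk q0 b0 by (intro mult_right_mono; simp)+
    then show ?thesis
      by (simp add: field_simps)
  qed
  ultimately have "(LINT x|lborel. u x * ?\<psi> x) \<le> a / (2 * real K) + R * real K * b + 3 / 4 * q"
    using far by linarith
  then show ?thesis
    by (simp add: a_def b_def q_def)
qed

text \<open>By Stone-Weierstrass the functions \<open>p \<beta>\<close>, with \<open>p\<close> a polynomial and \<open>\<beta>\<close> a fixed bump,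
  approximate every bounded function supported where \<open>\<beta>\<close> is bounded below. The hypothesis therefore
  passes to truncations \<open>f\<close> of \<open>u\<close>, for which \<open>f\<^sup>2 \<le> u f\<close>.\<close>

lemma square_integral_le_of_bump_bound:
  fixes u :: "'a::euclidean_space \<Rightarrow> real"
  assumes u: "loc_integrable u" and u2: "integrable lborel (\<lambda>x. (u x)\<^sup>2)" and R: "0 < R"
    and bound: "\<And>p. real_polynomial_function p \<Longrightarrow>
      (LINT x|lborel. u x * bump z R 0 p x) \<le> A + 3 / 4 * (LINT x|lborel. (bump z R 0 p x)\<^sup>2)"
  shows "(LINT x|lborel. indicator (ball z (R / 2)) x * (u x)\<^sup>2) \<le> 4 * A"
proof -
  have [measurable]: "u \<in> borel_measurable borel"
    using u unfolding loc_integrable_def by blast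
  let ?b = "ball z (R / 2)"
  have [measurable]: "?b \<in> sets borel" "cball z R \<in> sets borel"
    by simp_all
  define \<beta> where "\<beta> = bump z R 0 (\<lambda>_. 1)"
  have one: "real_polynomial_function (\<lambda>_::'a. 1)"
    by (rule real_polynomial_function.intros)
  have \<beta>_meas[measurable]: "\<beta> \<in> borel_measurable borel"
    unfolding \<beta>_def by (rule bump_measurable[OF one])
  have bump_\<beta>: "bump z R 0 p x = p x * \<beta> x" for p x
    by (simp add: \<beta>_def bump_def)
  have \<beta>01: "0 \<le> \<beta> x" "\<beta> x \<le> 1" for x
    using flat_exp_le_1 by (simp_all add: \<beta>_def bump_def)
  have \<beta>0: "\<beta> x = 0" if "x \<notin> cball z R" for x
    unfolding \<beta>_def using that R by (intro bump_eq_0) (auto simp: dist_commute)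
  \<comment> \<open>On the ball of half the radius,
    \<open>R\<^sup>2 - (x - z) \<bullet> (x - z)\<close> is at least
    \<open>3 / 4 * R\<^sup>2\<close>, and the flat function is increasing; this is its value at that
    point.\<close>
  define c where "c = exp (- 1 / (3 / 4 * R\<^sup>2))"
  have c: "0 < c"
    by (simp add: c_def)
  have \<beta>_ge: "c \<le> \<beta> x" if "x \<in> ?b" for x
  proof -
    have "norm (x - z) \<le> R / 2"
      using that by (simp add: dist_norm norm_minus_commute)
    then have "(norm (x - z))\<^sup>2 \<le> (R / 2)\<^sup>2"
      by (rule power_mono) simp
    then have s: "3 / 4 * R\<^sup>2 \<le> R\<^sup>2 - (x - z) \<bullet> (x - z)"
      by (simp add: power2_norm_eq_inner power_divide)
    have pos: "0 < 3 / 4 * R\<^sup>2"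
      using R by simp
    with s have s0: "0 < R\<^sup>2 - (x - z) \<bullet> (x - z)"
      by linarith
    have "- 1 / (3 / 4 * R\<^sup>2) \<le> - 1 / (R\<^sup>2 - (x - z) \<bullet> (x - z))"
      by (intro divide_left_mono_neg mult_pos_pos s s0 pos) simp
    with s0 show ?thesis
      by (simp add: \<beta>_def bump_def flat_exp_def c_def not_le)
  qed
  have step: "(LINT x|lborel. (indicator ?b x * max (- m) (min m (u x)))\<^sup>2) \<le> 4 * A" if m: "0 \<le> m" for m :: real
  proof -
    define f where "f x = indicator ?b x * max (- m) (min m (u x))" for x
    have [measurable]: "f \<in> borel_measurable borel"
      unfolding f_def[abs_def] by measurable
    have f_bd: "\<bar>f x\<bar> \<le> m" for x
      using m by (auto simp: f_def indicator_def)
    have f_supp: "f x = 0" if "x \<notin> cball z R" for x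
      using that R by (auto simp: f_def indicator_def)
    \<comment> \<open>The function to be approximated by polynomials. Outside the half ball the
      numerator is 0, so \<open>w\<close> vanishes there even where \<open>\<beta>\<close>
      does.\<close>
    define w where "w x = f x / \<beta> x" for x
    define B where "B = m / c"
    have B0: "0 \<le> B"
      using m c by (simp add: B_def)
    have w_bd: "\<bar>w x\<bar> \<le> B" for x
    proof (cases "x \<in> ?b")
      case True
      have "\<bar>f x\<bar> / \<beta> x \<le> m / c"
        using f_bd \<beta>_ge[OF True] c m by (intro frac_le) auto
      then show ?thesis
        using \<beta>01[of x] by (simp add: w_def B_def)
    next
      case False
      then show ?thesis
        using B0 by (simp add: w_def f_def)
    qed
    have w\<beta>: "w x * \<beta> x = f x" for x
    proof (cases "x \<in> ?b")
      case True
      then show ?thesis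
        using \<beta>_ge[OF True] c by (simp add: w_def)
    next
      case False
      then show ?thesis
        by (simp add: w_def f_def)
    qed
    have "w \<in> borel_measurable borel"
      unfolding w_def[abs_def] by measurable
    then have "w \<in> borel_measurable lebesgue"
      by (simp add: measurable_completion)
    \<comment> \<open>Stone-Weierstrass requires continuous functions, and \<open>w\<close> need not
      be one; it is an almost everywhere limit of continuous \<open>h n\<close>.\<close>
    then have "w measurable_on UNIV"
      by (intro lebesgue_measurable_imp_measurable_on_real) auto
    then obtain Z h where Z: "negligible Z" and h_cont: "\<And>n. continuous_on UNIV (h n)"
      and h_lim: "\<And>x. x \<notin> Z \<Longrightarrow> (\<lambda>n. h n x) \<longlonglongrightarrow> w x"
      unfolding measurable_on_def by auto
    \<comment> \<open>Clipping at \<open>B\<close> keeps the limit \<open>w\<close> unchanged and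
      makes the approximants uniformly bounded, as dominated convergence requires.\<close>
    define k where "k n x = max (- B) (min B (h n x))" for n x
    have k_cont: "continuous_on (cball z R) (k n)" for n
      unfolding k_def using h_cont continuous_on_subset by (intro continuous_intros) blast
    have k_bd: "\<bar>k n x\<bar> \<le> B" for n x
      using B0 by (auto simp: k_def)
    have k_lim: "(\<lambda>n. k n x) \<longlonglongrightarrow> w x" if "x \<notin> Z" for x
    proof -
      have "(\<lambda>n. k n x) \<longlonglongrightarrow> max (- B) (min B (w x))"
        unfolding k_def by (intro tendsto_intros h_lim that)
      moreover have "max (- B) (min B (w x)) = w x"
        using w_bd[of x] by (auto simp: abs_le_iff)
      ultimately show ?thesis
        by simp
    qed
    have "\<exists>p. real_polynomial_function p \<and> (\<forall>x\<in>cball z R. \<bar>k n x - p x\<bar> < 1 / real (Suc n))" for n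
    proof -
      have e0: "0 < 1 / real (Suc n)"
        by simp
      show ?thesis
        by (rule Stone_Weierstrass_real_polynomial_function[OF compact_cball k_cont[of n] e0])
          (rule exI, rule conjI, assumption, rule ballI)
    qed
    then have "\<forall>n. \<exists>p. real_polynomial_function p \<and> (\<forall>x\<in>cball z R. \<bar>k n x - p x\<bar> < 1 / real (Suc n))" ..
    from choice[OF this] obtain p where p: "\<And>n. real_polynomial_function (p n)"
      and p_close: "\<And>n x. x \<in> cball z R \<Longrightarrow> \<bar>k n x - p n x\<bar> < 1 / real (Suc n)"
      by blast
    let ?\<psi> = "\<lambda>n. bump z R 0 (p n)"
    have [measurable]: "?\<psi> n \<in> borel_measurable borel" for n
      by (rule bump_measurable[OF p])
    have \<psi>_bd: "\<bar>?\<psi> n x\<bar> \<le> (B + 1) * indicator (cball z R) x" for n x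
    proof (cases "x \<in> cball z R")
      case True
      have "1 / real (Suc n) \<le> 1"
        by simp
      then have "\<bar>p n x\<bar> \<le> B + 1"
        using p_close[OF True, of n] k_bd[of n x] by linarith
      then have "\<bar>p n x\<bar> * \<beta> x \<le> (B + 1) * 1"
        using \<beta>01[of x] B0 by (intro mult_mono) auto
      then show ?thesis
        using True \<beta>01[of x] by (simp add: bump_\<beta> abs_mult)
    next
      case False
      then show ?thesis
        by (simp add: bump_\<beta> \<beta>0)
    qed
    have \<psi>_lim: "(\<lambda>n. ?\<psi> n x) \<longlonglongrightarrow> f x" if "x \<notin> Z" for x
    proof (cases "x \<in> cball z R")
      case True
      have "(\<lambda>n. k n x - p n x) \<longlonglongrightarrow> 0"
      proof (rule Lim_null_comparison)
        show "\<forall>\<^sub>F n in sequentially. norm (k n x - p n x) \<le> 1 / real (Suc n)"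
          using p_close[OF True] by (intro always_eventually allI) (simp add: less_imp_le)
        show "(\<lambda>n. 1 / real (Suc n)) \<longlonglongrightarrow> 0"
          by (rule LIMSEQ_Suc) (rule lim_1_over_n)
      qed
      from tendsto_diff[OF k_lim[OF that] this] have "(\<lambda>n. p n x) \<longlonglongrightarrow> w x"
        by simp
      then have "(\<lambda>n. p n x * \<beta> x) \<longlonglongrightarrow> w x * \<beta> x"
        by (intro tendsto_intros)
      then show ?thesis
        by (simp add: bump_\<beta> w\<beta>)
    next
      case False
      then show ?thesis
        by (simp add: bump_\<beta> \<beta>0 f_supp)
    qed
    \<comment> \<open>\<open>Z\<close> is negligible for completed Lebesgue measure; almost
      everywhere statements transfer from the completion to \<open>lborel\<close>.\<close>
    have "Z \<in> null_sets lebesgue"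
      using Z by (simp add: negligible_iff_null_sets)
    then have "AE x in lebesgue. x \<notin> Z"
      by (rule AE_not_in)
    then have AE_lim: "AE x in lborel. (\<lambda>n. ?\<psi> n x) \<longlonglongrightarrow> f x"
      unfolding AE_completion_iff by (auto elim!: eventually_mono intro: \<psi>_lim)
    have u_dom: "integrable lborel (\<lambda>x. \<bar>u x * ((B + 1) * indicator (cball z R) x)\<bar>)"
      using B0 by (intro integrable_abs loc_integrable_mult[OF u, where C="B + 1" and z=z and \<rho>=R])
        (auto simp: indicator_def)
    have lim1: "(\<lambda>n. LINT x|lborel. u x * ?\<psi> n x) \<longlonglongrightarrow> (LINT x|lborel. u x * f x)"
    proof (rule integral_dominated_convergence[OF _ _ u_dom])
      show "AE x in lborel. (\<lambda>n. u x * ?\<psi> n x) \<longlonglongrightarrow> u x * f x"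
        using AE_lim by (auto elim!: eventually_mono intro: tendsto_intros)
      show "AE x in lborel. norm (u x * ?\<psi> n x) \<le> \<bar>u x * ((B + 1) * indicator (cball z R) x)\<bar>" for n
        using \<psi>_bd[of n] B0 by (intro AE_I2) (simp add: abs_mult mult_left_mono)
    qed measurable
    have one_loc: "loc_integrable (\<lambda>_::'a. 1::real)"
      unfolding loc_integrable_def set_integrable_def by (intro conjI allI impI borel_integrable_compact) auto
    have dom2: "integrable lborel (\<lambda>x::'a. ((B + 1) * indicator (cball z R) x)\<^sup>2)"
    proof -
      have "integrable lborel (\<lambda>x::'a. 1 * ((B + 1) * indicator (cball z R) x)\<^sup>2)"
        by (intro loc_integrable_mult[OF one_loc, where C="(B + 1)\<^sup>2" and z=z and \<rho>=R]) (auto simp: indicator_def)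
      then show ?thesis
        by simp
    qed
    have lim2: "(\<lambda>n. LINT x|lborel. (?\<psi> n x)\<^sup>2) \<longlonglongrightarrow> (LINT x|lborel. (f x)\<^sup>2)"
    proof (rule integral_dominated_convergence[OF _ _ dom2])
      show "AE x in lborel. (\<lambda>n. (?\<psi> n x)\<^sup>2) \<longlonglongrightarrow> (f x)\<^sup>2"
        using AE_lim by (auto elim!: eventually_mono intro: tendsto_intros)
      show "AE x in lborel. norm ((?\<psi> n x)\<^sup>2) \<le> ((B + 1) * indicator (cball z R) x)\<^sup>2" for n
      proof (intro AE_I2)
        fix x
        have "\<bar>?\<psi> n x\<bar>\<^sup>2 \<le> ((B + 1) * indicator (cball z R) x)\<^sup>2"
          by (intro power_mono \<psi>_bd) simp
        then show "norm ((?\<psi> n x)\<^sup>2) \<le> ((B + 1) * indicator (cball z R) x)\<^sup>2"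
          by simp
      qed
    qed measurable
    have "(LINT x|lborel. u x * f x) \<le> A + 3 / 4 * (LINT x|lborel. (f x)\<^sup>2)"
    proof (rule LIMSEQ_le[OF lim1])
      show "(\<lambda>n. A + 3 / 4 * (LINT x|lborel. (?\<psi> n x)\<^sup>2)) \<longlonglongrightarrow> A + 3 / 4 * (LINT x|lborel. (f x)\<^sup>2)"
        by (intro tendsto_intros lim2)
    qed (use bound[OF p] in blast)
    \<comment> \<open>Truncation keeps the sign of \<open>u\<close> and does not increase its
      absolute value, hence the pointwise inequality.\<close>
    moreover have "(LINT x|lborel. (f x)\<^sup>2) \<le> (LINT x|lborel. u x * f x)"
    proof (rule integral_mono)
      show "integrable lborel (\<lambda>x. u x * f x)"
        using f_bd f_supp by (intro loc_integrable_mult[OF u, where C=m and z=z and \<rho>=R]) auto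
      have "integrable lborel (\<lambda>x. 1 * (f x)\<^sup>2)"
      proof (rule loc_integrable_mult[OF one_loc, where C="m\<^sup>2" and z=z and \<rho>=R])
        show "\<bar>(f x)\<^sup>2\<bar> \<le> m\<^sup>2" for x
          using power_mono[OF f_bd[of x], of 2] by simp
      qed (auto simp: f_supp)
      then show "integrable lborel (\<lambda>x. (f x)\<^sup>2)"
        by simp
      fix x
      have "max (- m) (min m v) * max (- m) (min m v) \<le> v * max (- m) (min m v)" for v
      proof (cases "0 \<le> v")
        case True
        then show ?thesis
          using m by (intro mult_right_mono) auto
      next
        case False
        then show ?thesis
          using m by (intro mult_right_mono_neg) auto
      qed
      then show "(f x)\<^sup>2 \<le> u x * f x"
        by (simp add: f_def indicator_def power2_eq_square)
    qed
    \<comment> \<open>The finite integral of \<open>f\<^sup>2\<close> is at most \<open>A\<close>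
      plus 3/4 of itself; absorbing that part gives the factor 4.\<close>
    ultimately show ?thesis
      by (simp add: f_def)
  qed
  \<comment> \<open>The truncation level now tends to infinity. The truncated squares are dominated
    by \<open>u\<^sup>2\<close>, and at each point the truncation is eventually inactive.\<close>
  have "(\<lambda>n. LINT x|lborel. (indicator ?b x * max (- real n) (min (real n) (u x)))\<^sup>2) \<longlonglongrightarrow>
      (LINT x|lborel. (indicator ?b x * u x)\<^sup>2)"
  proof (rule integral_dominated_convergence[OF _ _ u2])
    show "AE x in lborel. (\<lambda>n. (indicator ?b x * max (- real n) (min (real n) (u x)))\<^sup>2) \<longlonglongrightarrow> (indicator ?b x * u x)\<^sup>2"
    proof (intro AE_I2)
      fix x
      have "eventually (\<lambda>n. \<bar>u x\<bar> \<le> real n) sequentially"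
        using eventually_ge_at_top[of "nat \<lceil>\<bar>u x\<bar>\<rceil>"]
        by eventually_elim linarith
      then have "eventually (\<lambda>n. (indicator ?b x * u x)\<^sup>2 = (indicator ?b x * max (- real n) (min (real n) (u x)))\<^sup>2) sequentially"
        by eventually_elim (auto simp: abs_le_iff)
      then show "(\<lambda>n. (indicator ?b x * max (- real n) (min (real n) (u x)))\<^sup>2) \<longlonglongrightarrow> (indicator ?b x * u x)\<^sup>2"
        by (rule Lim_transform_eventually[OF tendsto_const])
    qed
    show "AE x in lborel. norm ((indicator ?b x * max (- real n) (min (real n) (u x)))\<^sup>2) \<le> (u x)\<^sup>2" for n
    proof (intro AE_I2)
      fix x
      have "\<bar>indicator ?b x * max (- real n) (min (real n) (u x))\<bar> \<le> \<bar>u x\<bar>"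
        by (auto simp: indicator_def)
      then have "\<bar>indicator ?b x * max (- real n) (min (real n) (u x))\<bar>\<^sup>2 \<le> \<bar>u x\<bar>\<^sup>2"
        by (rule power_mono) simp
      then show "norm ((indicator ?b x * max (- real n) (min (real n) (u x)))\<^sup>2) \<le> (u x)\<^sup>2"
        by simp
    qed
  qed measurable
  then have "(LINT x|lborel. (indicator ?b x * u x)\<^sup>2) \<le> 4 * A"
    by (rule LIMSEQ_le_const2) (use step in auto)
  also have "(\<lambda>x. (indicator ?b x * u x)\<^sup>2) = (\<lambda>x. indicator ?b x * (u x)\<^sup>2)"
    by (auto simp: indicator_def)
  finally show ?thesis .
qed

section \<open>Uniform radii for bounded sets, and the conclusion\<close>

lemma Lp_norm_2_square:
  fixes f :: "'a::euclidean_space \<Rightarrow> 'b::euclidean_space"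
  shows "(Lp_norm 2 f)\<^sup>2 = (LINT x|lborel. (norm (f x))\<^sup>2)"
  by (simp add: Lp_norm_def powr_half_sqrt)

text \<open>The two preceding lemmas bound the mass by
  \<open>2 * a / real K + 4 * (R * real K * b)\<close>. First \<open>K\<close> is taken large enough
  to make the first term at most \<open>\<kappa> / 2\<close>, then \<open>R\<close> small depending
  on \<open>K\<close>. The two entries of the minimum in \<open>R\<close> serve the hypothesis of
  \<open>weak_bound\<close> and the second term.\<close>

lemma H1_equiconcentrated:
  assumes \<kappa>: "0 < \<kappa>"
  obtains r where "0 < r"
    "\<And>(u :: 'a::euclidean_space \<Rightarrow> real) z. in_H1 u \<Longrightarrow> H1_norm u \<le> M \<Longrightarrow>
      (LINT x|lborel. indicator (ball z r) x * (u x)\<^sup>2) \<le> \<kappa>"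
proof -
  \<comment> \<open>The summand 1 keeps \<open>B\<close> positive, so that it may appear in a
    denominator.\<close>
  define B where "B = M\<^sup>2 + 1"
  have B: "0 < B"
    by (simp add: B_def add_nonneg_pos)
  define K where "K = nat \<lceil>4 * B / \<kappa>\<rceil> + 1"
  have K: "0 < K" "4 * B / \<kappa> \<le> real K"
    unfolding K_def by linarith+
  define R where "R = min (1 / (4 * real K)) (\<kappa> / (8 * real K * B))"
  have R: "0 < R"
    using K B \<kappa> by (simp add: R_def)
  have "R \<le> 1 / (4 * real K)" "R \<le> \<kappa> / (8 * real K * B)"
    by (simp_all add: R_def)
  then have RK: "2 * R * real K \<le> 1 / 2" "4 * (R * real K * B) \<le> \<kappa> / 2"
    using K B by (simp_all add: field_simps)
  have KB: "2 * B / real K \<le> \<kappa> / 2"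
    using K \<kappa> B by (simp add: field_simps)
  have "(LINT x|lborel. indicator (ball z (R / 2)) x * (u x)\<^sup>2) \<le> \<kappa>"
    if H1: "in_H1 u" "H1_norm u \<le> M" for u :: "'a \<Rightarrow> real" and z
  proof -
    define g where "g = weak_gradient u"
    have "has_weak_gradient u g \<and> in_Lp 2 g"
      using H1(1) unfolding in_H1_def g_def weak_gradient_def by (metis (mono_tags, lifting) someI_ex)
    then have wg: "has_weak_gradient u g" and g: "in_Lp 2 g"
      by auto
    have u2: "integrable lborel (\<lambda>x. (u x)\<^sup>2)" and g2: "integrable lborel (\<lambda>x. (norm (g x))\<^sup>2)"
      using H1(1) g by (simp_all add: in_H1_def in_Lp_def)
    define a b where "a = (LINT x|lborel. (u x)\<^sup>2)" and "b = (LINT x|lborel. (norm (g x))\<^sup>2)"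
    have ab0: "0 \<le> a" "0 \<le> b"
      by (simp_all add: a_def b_def)
    have "sqrt (a + b) \<le> M"
      using H1(2) by (simp add: H1_norm_def Lp_norm_2_square a_def b_def g_def)
    then have "a + b \<le> M\<^sup>2"
      by (rule sqrt_le_D)
    then have ab: "a \<le> B" "b \<le> B"
      using ab0 by (auto simp: B_def)
    define A where "A = a / (2 * real K) + R * real K * b"
    have "(LINT x|lborel. indicator (ball z (R / 2)) x * (u x)\<^sup>2) \<le> 4 * A"
    proof (rule square_integral_le_of_bump_bound[OF _ u2 R])
      show "loc_integrable u"
        using wg unfolding has_weak_gradient_def by blast
      show "(LINT x|lborel. u x * bump z R 0 p x) \<le> A + 3 / 4 * (LINT x|lborel. (bump z R 0 p x)\<^sup>2)"
        if "real_polynomial_function p" for p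
        using weak_bound[OF wg u2 g2 that R K(1) RK(1)] by (simp add: A_def a_def b_def)
    qed
    also have "4 * A = 2 * a / real K + 4 * (R * real K * b)"
      by (simp add: A_def)
    also have "\<dots> \<le> 2 * B / real K + 4 * (R * real K * B)"
      using ab R by (intro add_mono divide_right_mono mult_left_mono) auto
    also have "\<dots> \<le> \<kappa>"
      using KB RK(2) by linarith
    finally show ?thesis .
  qed
  with R show thesis
    by (intro that[of "R / 2"]) auto
qed

text \<open>At a point where \<open>\<rho>\<close> is negative, \<open>sqrt\<close> is negative too
  and its square is the absolute value of \<open>\<rho>\<close>; the two integrands therefore agree
  only almost everywhere.\<close>

lemma emeasure_density_measure_sqrt:
  fixes \<rho> :: "'a::euclidean_space \<Rightarrow> real"
  assumes \<rho>: "prob_density \<rho>" and [measurable]: "A \<in> sets borel"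
  shows "emeasure (density_measure \<rho>) A = ennreal (LINT x|lborel. indicator A x * (sqrt (\<rho> x))\<^sup>2)"
proof -
  note [measurable] = prob_densityD(1)[OF \<rho>]
  have eq: "AE x in lborel. indicator A x * (sqrt (\<rho> x))\<^sup>2 = indicator A x * \<rho> x"
    using prob_densityD(3)[OF \<rho>] by eventually_elim simp
  have int: "integrable lborel (\<lambda>x. indicator A x * \<rho> x)"
    using integrable_real_mult_indicator[of A lborel \<rho>] prob_densityD(2)[OF \<rho>] by (simp add: mult.commute)
  have "emeasure (density_measure \<rho>) A = (\<integral>\<^sup>+x. ennreal (indicator A x * \<rho> x) \<partial>lborel)"
    by (subst emeasure_density) (auto intro!: nn_integral_cong simp: indicator_def)
  also have "\<dots> = ennreal (LINT x|lborel. indicator A x * \<rho> x)"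
    using prob_densityD(3)[OF \<rho>] by (intro nn_integral_eq_integral int) (auto elim!: eventually_mono)
  also have "(LINT x|lborel. indicator A x * \<rho> x) = (LINT x|lborel. indicator A x * (sqrt (\<rho> x))\<^sup>2)"
    by (rule integral_cong_AE) (use eq in \<open>auto elim!: eventually_mono\<close>)
  finally show ?thesis .
qed

theorem corollary3p12:
  fixes \<phi> :: "real \<Rightarrow> real" and N :: nat and p :: real
  assumes "N > 1"
    and "continuous_on {0<..} \<phi>"
    and "strict_antimono_on {0<..} \<phi>"
    and "\<And>t. t > 0 \<Longrightarrow> \<phi> t \<ge> 0"
    and "filterlim \<phi> at_top (at_right 0)"
    and "p > 1"
  shows "(\<forall>M>0. \<exists>L. cost_L1_lipschitz_on L \<phi> N
            {\<rho> :: real ^ 'd \<Rightarrow> real. prob_density \<rho> \<and> in_Lp p \<rho> \<and> Lp_norm p \<rho> \<le> M}) \<and>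
         (\<forall>S \<subseteq> (H_densities :: (real ^ 3 \<Rightarrow> real) set).
            (\<exists>M. \<forall>\<rho>\<in>S. H1_norm (\<lambda>x. sqrt (\<rho> x)) \<le> M) \<longrightarrow>
            (\<exists>L. cost_L1_lipschitz_on L \<phi> N S))"
proof -
  interpret repulsive_cost \<phi> N
  proof
    show "\<phi> t \<le> \<phi> s" if "0 < s" "s \<le> t" for s t
      using assms(3) that by (cases "s = t") (auto simp: monotone_on_def less_imp_le)
  qed (use assms in auto)
  \<comment> \<open>The concentration level demanded by
    \<open>cost_lipschitz_if_equiconcentrated\<close>; each half of the claim only has to provide
    one radius valid for the whole set.\<close>
  define \<kappa> where "\<kappa> = 1 / (4 * real N ^ 4)"
  have \<kappa>: "0 < \<kappa>"
    using assms(1) by (simp add: \<kappa>_def)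
  show ?thesis
  proof (intro conjI allI impI)
    fix M :: real
    obtain r where "0 < r" "\<And>(\<rho> :: real ^ 'd \<Rightarrow> real) z. in_Lp p \<rho> \<Longrightarrow> Lp_norm p \<rho> \<le> M \<Longrightarrow>
       emeasure (density_measure \<rho>) (ball z r) \<le> ennreal \<kappa>"
      by (rule Lp_equiconcentrated[OF assms(6) \<kappa>]) blast
    then show "\<exists>L. cost_L1_lipschitz_on L \<phi> N
        {\<rho> :: real ^ 'd \<Rightarrow> real. prob_density \<rho> \<and> in_Lp p \<rho> \<and> Lp_norm p \<rho> \<le> M}"
      unfolding \<kappa>_def by (intro cost_lipschitz_if_equiconcentrated) auto
  next
    fix S :: "(real ^ 3 \<Rightarrow> real) set"
    assume S: "S \<subseteq> H_densities" and "\<exists>M. \<forall>\<rho>\<in>S. H1_norm (\<lambda>x. sqrt (\<rho> x)) \<le> M"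
    then obtain M where M: "\<And>\<rho>. \<rho> \<in> S \<Longrightarrow> H1_norm (\<lambda>x. sqrt (\<rho> x)) \<le> M"
      by blast
    have dens: "prob_density \<rho>" "in_H1 (\<lambda>x. sqrt (\<rho> x))" if "\<rho> \<in> S" for \<rho>
      using S that by (auto simp: H_densities_def prob_density_def)
    obtain r where r: "0 < r" "\<And>(u :: real ^ 3 \<Rightarrow> real) z. in_H1 u \<Longrightarrow> H1_norm u \<le> M \<Longrightarrow>
        (LINT x|lborel. indicator (ball z r) x * (u x)\<^sup>2) \<le> \<kappa>"
      by (rule H1_equiconcentrated[OF \<kappa>]) blast
    have "emeasure (density_measure \<rho>) (ball z r) \<le> ennreal (1 / (4 * real N ^ 4))" if "\<rho> \<in> S" for \<rho> z
      using r(2)[OF dens(2) M, OF that that, of z] emeasure_density_measure_sqrt[OF dens(1)[OF that], of "ball z r"]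
      by (simp add: \<kappa>_def ennreal_leI)
    then show "\<exists>L. cost_L1_lipschitz_on L \<phi> N S"
      using r(1) dens(1) by (intro cost_lipschitz_if_equiconcentrated)
  qed
qed

end
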